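(* Suppose that, for some $\rho > 0$, $e^{\rho|x|}q(x) \in W^{1,\infty}(\mathbf{R};\mathbf{R})$. Consider the system $$\psi_t(x,t) = i\omega\,\psi(x,t) + \omega\, a(t)\, q(x-t), \qquad \dot a(t) = -\frac{1}{\omega}\int_{\mathbf{R}} \Re[\psi(x,t)]\, q(x-t)\,dx. \qquad ( * )$$ (1) The solution of $( * )$ with initial data $\psi(x,0) = 0$ and $a(0) = a_0\in\mathbf{R}$ satisfies, for all $\omega$ sufficiently large, $$\psi(t+l,t) = a_0\,\omega\, r_\omega\,\sigma_\omega(l)\, e^{-\theta_\omega t} + \eta(l,t)\qquad (l\in\mathbf{R},\ t\ge 0).$$ Here $\sigma_\omega(l) := \int_0^\infty e^{(\theta_\omega + i\omega)t}\, q(t+l)\,dt$, $r_\omega = 1+\mathcal{O}(1/\omega)$ is a real number depending on $q$ and $\omega$ but not on $a_0$ or $l$, and $\|\eta(l,\cdot)\|_{\rho'} < \infty$ for all $\rho' < \rho/2$ and every $l\in\mathbf{R}$. (2) Additionally, if $e^{\rho|x|}\psi_0(x) \in L^\infty(\mathbf{R};\mathbf{C})$, then the solution of $( * )$ with initial data $\psi(x,0) = \psi_0(x)$ and $a(0) = a_0\in\mathbf{R}$ satisfies, for all $\omega$ sufficiently large, $$\psi(t+l,t) = \beta\,\omega\, r_\omega\,\sigma_\omega(l)\, e^{-\theta_\omega t} + \eta(l,t)\qquad (l\in\mathbf{R},\ t\ge 0)$$ for some finite constant $\beta = \beta(\psi_0,a_0)\in\mathbf{R}$ (independent of $l$ and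 $t$), where $r_\omega$ is as in (1) and (the possibly different function) $\eta$ again satisfies $\|\eta(l,\cdot)\|_{\rho'}<\infty$ for all $\rho'<\rho/2$ and every $l\in\mathbf{R}$.
   Context: The unknowns are $\psi(x,t)\in\mathbf{C}$ and $a(t)\in\mathbf{R}$, for $x,t\in\mathbf{R}$; $\omega>0$ is a parameter. For $q\in L^2(\mathbf{R};\mathbf{R})$, $\psi_0\in L^2(\mathbf{R};\mathbf{C})$ and $a_0\in\mathbf{R}$, "the solution" is the unique $(\psi,a)\in C^1(\mathbf{R};L^2(\mathbf{R};\mathbf{C})\times\mathbf{R})$ satisfying the system with the given initial data. Pointwise values of $\psi$ are those given by $\psi(x,t) = e^{i\omega t}\psi_0(x)+\omega\int_0^t e^{i\omega(t-s)}a(s)q(x-s)\,ds$, with $\psi_0$ a representative satisfying $\sup_x e^{\rho|x|}|\psi_0(x)|<\infty$. For $f:\mathbf{R}^+\to\mathbf{C}$ and a real number $\rho'$, $\|f\|_{\rho'} := \sup_{t\ge 0} e^{\rho' t}|f(t)|$. The number $\theta_\omega$ is defined as follows: let $(q\star q)(t) := \int_{\mathbf{R}} q(x+t)q(x)\,dx$, $K_\omega(z) := \int_0^\infty e^{-zt}\cos(\omega t)\,(q\star q)(t)\,dt$, and $V_\omega(z) := 1/(z+K_\omega(z))$; for $\omega$ sufficiently large $V_\omega$ has exactly one pole in $\{\Re(z)\ge -\rho/2\}$, which is real and simple, and $-\theta_\omega$ denotes its location (so $\theta_\omega = 2\pi^2|\hat q(\omega)|^2(1+\mathcal{O}(1/\omega))$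 with $\hat q(k)=\frac1{2\pi}\int_{\mathbf{R}}e^{-ikx}q(x)\,dx$). Thus $\sigma_\omega(l)=Q_l(-\theta_\omega-i\omega)$, where $Q_l(z):=\int_0^\infty e^{-zt}q(t+l)\,dt$ is the Laplace transform of $q(\cdot+l)$. The notation $\mathcal{O}(1/\omega)$ denotes a quantity bounded in absolute value by $C/\omega$ for all sufficiently large $\omega$, with $C$ independent of $\omega$. *)

theory Defs
  imports "HOL-Complex_Analysis.Complex_Analysis" "HOL-Library.Landau_Symbols"
begin

section \<open>Function spaces\<close>

text \<open>Elements of \<open>L\<^sup>2\<close> and \<open>L\<^sup>\<infinity>\<close> are given by Borel representatives; equality in these
  spaces is equality almost everywhere.\<close>

definition L_infty :: "(real \<Rightarrow> real) \<Rightarrow> bool" where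
  "L_infty f \<longleftrightarrow> f \<in> borel_measurable lborel \<and> (\<exists>C. AE x in lborel. \<bar>f x\<bar> \<le> C)"

text \<open>The test functions range over \<open>C\<^sup>1\<^sub>c\<close>, as is usual in one dimension; by mollification
  \<open>C\<^sup>\<infinity>\<^sub>c\<close> gives the same notion for locally integrable \<open>f\<close> and \<open>g\<close>.\<close>

definition weak_derivative :: "(real \<Rightarrow> real) \<Rightarrow> (real \<Rightarrow> real) \<Rightarrow> bool" where
  "weak_derivative f g \<longleftrightarrow>
     (\<forall>\<phi> \<phi>'. (\<forall>x. (\<phi> has_real_derivative \<phi>' x) (at x)) \<longrightarrow> continuous_on UNIV \<phi>' \<longrightarrow>
        (\<exists>R. \<forall>x. \<bar>x\<bar> > R \<longrightarrow> \<phi> x = 0) \<longrightarrow>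
        (LINT x|lborel. f x * \<phi>' x) = - (LINT x|lborel. g x * \<phi> x))"

definition W1_infty :: "(real \<Rightarrow> real) \<Rightarrow> bool" where
  "W1_infty f \<longleftrightarrow> L_infty f \<and> (\<exists>g. L_infty g \<and> weak_derivative f g)"

definition L2_fun :: "(real \<Rightarrow> complex) \<Rightarrow> bool" where
  "L2_fun f \<longleftrightarrow> f \<in> borel_measurable lborel \<and> integrable lborel (\<lambda>x. (cmod (f x))\<^sup>2)"

definition L2_norm :: "(real \<Rightarrow> complex) \<Rightarrow> real" where
  "L2_norm f = sqrt (LINT x|lborel. (cmod (f x))\<^sup>2)"

text \<open>The curve \<open>t \<mapsto> \<psi>(\<cdot>,t)\<close> belongs to \<open>C\<^sup>1(\<real>;L\<^sup>2)\<close> with derivative \<open>t \<mapsto> \<psi>'(\<cdot>,t)\<close>; here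
  \<open>\<psi> x t\<close> stands for \<open>\<psi>(x,t)\<close>.\<close>

definition L2_C1_curve :: "(real \<Rightarrow> real \<Rightarrow> complex) \<Rightarrow> (real \<Rightarrow> real \<Rightarrow> complex) \<Rightarrow> bool" where
  "L2_C1_curve \<psi> \<psi>' \<longleftrightarrow>
     (\<forall>t. L2_fun (\<lambda>x. \<psi> x t) \<and> L2_fun (\<lambda>x. \<psi>' x t)) \<and>
     (\<forall>t. ((\<lambda>h. L2_norm (\<lambda>x. (\<psi> x (t + h) - \<psi> x t) / of_real h - \<psi>' x t)) \<longlongrightarrow> 0) (at 0)) \<and>
     (\<forall>t. ((\<lambda>s. L2_norm (\<lambda>x. \<psi>' x s - \<psi>' x t)) \<longlongrightarrow> 0) (at t))"

definition weighted_norm :: "real \<Rightarrow> (real \<Rightarrow> complex) \<Rightarrow> ennreal" where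
  "weighted_norm \<rho>' f = (SUP t\<in>{0..}. ennreal (exp (\<rho>' * t) * cmod (f t)))"

section \<open>The system\<close>

definition C1_solution ::
  "real \<Rightarrow> (real \<Rightarrow> real) \<Rightarrow> (real \<Rightarrow> complex) \<Rightarrow> real \<Rightarrow> (real \<Rightarrow> real \<Rightarrow> complex) \<Rightarrow> (real \<Rightarrow> real) \<Rightarrow> bool"
where
  "C1_solution \<omega> q \<psi>\<^sub>0 a\<^sub>0 \<psi> a \<longleftrightarrow>
     (\<exists>\<psi>' a'. L2_C1_curve \<psi> \<psi>' \<and>
        (\<forall>t. (a has_real_derivative a' t) (at t)) \<and> continuous_on UNIV a' \<and>
        (\<forall>t. AE x in lborel.
           \<psi>' x t = \<i> * of_real \<omega> * \<psi> x t + of_real (\<omega> * a t * q (x - t))) \<and>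
        (\<forall>t. a' t = - (1 / \<omega>) * (LINT x|lborel. Re (\<psi> x t) * q (x - t)))) \<and>
     (AE x in lborel. \<psi> x 0 = \<psi>\<^sub>0 x) \<and> a 0 = a\<^sub>0"

text \<open>A solution determines \<open>\<psi>(\<cdot>,t)\<close> only almost everywhere; Duhamel's formula selects the
  representative whose pointwise values are meant. The interval integral is oriented, so
  negative \<open>t\<close> is covered.\<close>

definition duhamel ::
  "real \<Rightarrow> (real \<Rightarrow> real) \<Rightarrow> (real \<Rightarrow> complex) \<Rightarrow> (real \<Rightarrow> real) \<Rightarrow> real \<Rightarrow> real \<Rightarrow> complex"
where
  "duhamel \<omega> q \<psi>\<^sub>0 a x t =
     exp (\<i> * of_real (\<omega> * t)) * \<psi>\<^sub>0 x +
     of_real \<omega> * (LBINT s=0..t. exp (\<i> * of_real (\<omega> * (t - s))) * of_real (a s * q (x - s)))"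

definition solution ::
  "real \<Rightarrow> (real \<Rightarrow> real) \<Rightarrow> (real \<Rightarrow> complex) \<Rightarrow> real \<Rightarrow> (real \<Rightarrow> real \<Rightarrow> complex) \<Rightarrow> (real \<Rightarrow> real) \<Rightarrow> bool"
where
  "solution \<omega> q \<psi>\<^sub>0 a\<^sub>0 \<psi> a \<longleftrightarrow>
     C1_solution \<omega> q \<psi>\<^sub>0 a\<^sub>0 \<psi> a \<and> (\<forall>x t. \<psi> x t = duhamel \<omega> q \<psi>\<^sub>0 a x t)"

section \<open>The decay rate and the profile\<close>

definition autocorr :: "(real \<Rightarrow> real) \<Rightarrow> real \<Rightarrow> real" where
  "autocorr q t = (LINT x|lborel. q (x + t) * q x)"

definition K_fun :: "(real \<Rightarrow> real) \<Rightarrow> real \<Rightarrow> complex \<Rightarrow> complex" where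
  "K_fun q \<omega> z = (LINT t:{0..}|lborel. exp (- z * of_real t) * of_real (cos (\<omega> * t) * autocorr q t))"

definition V_fun :: "(real \<Rightarrow> real) \<Rightarrow> real \<Rightarrow> complex \<Rightarrow> complex" where
  "V_fun q \<omega> z = 1 / (z + K_fun q \<omega> z)"

text \<open>\<open>V_fun\<close> takes the value \<open>1 / 0 = 0\<close> at its poles, which is irrelevant for \<open>is_pole\<close> and
  \<open>zorder\<close>: both depend only on punctured neighbourhoods.\<close>

definition unique_simple_pole_at :: "real \<Rightarrow> (real \<Rightarrow> real) \<Rightarrow> real \<Rightarrow> real \<Rightarrow> bool" where
  "unique_simple_pole_at \<rho> q \<omega> p \<longleftrightarrow>
     p \<ge> - \<rho> / 2 \<and> is_pole (V_fun q \<omega>) (of_real p) \<and> zorder (V_fun q \<omega>) (of_real p) = - 1 \<and>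
     (\<forall>z. Re z \<ge> - \<rho> / 2 \<and> is_pole (V_fun q \<omega>) z \<longrightarrow> z = of_real p)"

definition theta :: "real \<Rightarrow> (real \<Rightarrow> real) \<Rightarrow> real \<Rightarrow> real" where
  "theta \<rho> q \<omega> = - (THE p. unique_simple_pole_at \<rho> q \<omega> p)"

definition sigma_fun :: "real \<Rightarrow> (real \<Rightarrow> real) \<Rightarrow> real \<Rightarrow> real \<Rightarrow> complex" where
  "sigma_fun \<rho> q \<omega> l =
     (LINT t:{0..}|lborel. exp ((of_real (theta \<rho> q \<omega>) + \<i> * of_real \<omega>) * of_real t) * of_real (q (t + l)))"

end

theory Submission
  imports Defs
begin

text \<open>Duhamel's formula turns the system into the Volterra equation \<open>a' = f - k * a\<close> with
  \<open>k t = cos (\<omega> t) (q \<star> q) t\<close> and exponentially decaying \<open>f\<close>. No Laplace inversion is needed: since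
  \<open>-\<theta>\<close> is a zero of \<open>z + K\<^sub>\<omega> z\<close>, the weighted kernel \<open>exp (\<theta> t) k t\<close> has integral \<open>\<theta>\<close>, and
  \<open>b t = exp (\<theta> t) a t\<close> satisfies \<open>b = a\<^sub>0 + \<integral> exp (\<theta> s) f s + \<kappa> * b\<close>, where \<open>\<kappa>\<close> is the tail integral of
  the weighted kernel. As \<open>q \<star> q\<close> is Lipschitz with exponential weight, oscillation makes \<open>\<kappa>\<close> of size
  \<open>1 / \<omega>\<close> in a weighted \<open>L\<^sup>1\<close> norm, so \<open>b\<close> converges exponentially to \<open>\<beta> r\<close> with
  \<open>r = 1 / (1 - \<integral> \<kappa>)\<close> (the residue of \<open>V\<^sub>\<omega>\<close>) and \<open>\<beta> = a\<^sub>0 + \<integral> exp (\<theta> s) f s\<close>. The same \<open>1 / \<omega>\<close> bound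
  makes \<open>-K\<^sub>\<omega>\<close> a contraction near \<open>0\<close>, whence the unique simple real pole.\<close>

section \<open>Integrals on half-lines and convolutions\<close>

text \<open>The amplitude equation is not itself a small perturbation: in general the L^1 norm of
  the weighted kernel does not shrink as \<omega> grows, because absolute values destroy the
  oscillation. Only its primitive \<kappa> is O(1/\<omega>), so the equation has to be integrated
  once before any norm is taken. The value of r comes from \<integral> \<kappa> = \<integral> t k(t)
  dt, which makes 1 - \<integral> \<kappa> the derivative of z + K z at -\<theta>.

  The decay rate \<rho> is spent in steps: \<rho> for q, 3/4 \<rho> for its autocorrelation, 5/8
  \<rho> for uniform bounds on transforms, \<rho>/2 for the error. Since |\<theta>| \<le> \<rho>/16
  for large \<omega>, each step keeps a gap independent of \<omega>, and these gaps are the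
  denominators in the constants.

  The hypothesis on q speaks only of a weak derivative and of bounds almost everywhere, while the
  conclusion holds at every l and t. Hence q is first replaced by a representative with a bound at
  every point, and its regularity is used only as a Lipschitz bound for finite differences.\<close>

lemma dominated_integral:
  fixes f :: "'a \<Rightarrow> 'b::{banach, second_countable_topology}"
  assumes "f \<in> borel_measurable M" "integrable M g" "AE x in M. norm (f x) \<le> g x"
  shows "integrable M f" "norm (integral\<^sup>L M f) \<le> integral\<^sup>L M g"
proof -
  show i: "integrable M f"
    by (rule Bochner_Integration.integrable_bound[OF assms(2,1)]) (use assms(3) in auto)
  have "norm (integral\<^sup>L M f) \<le> (\<integral>x. norm (f x) \<partial>M)" by simp
  also have "\<dots> \<le> integral\<^sup>L M g"
    by (intro integral_mono_AE assms i integrable_norm)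
  finally show "norm (integral\<^sup>L M f) \<le> integral\<^sup>L M g" .
qed

lemma dominated_set_integral:
  fixes f :: "'a \<Rightarrow> 'b::{banach, second_countable_topology}"
  assumes "A \<in> sets M" "f \<in> borel_measurable M" "set_integrable M A g"
    and "\<And>x. x \<in> A \<Longrightarrow> norm (f x) \<le> g x"
  shows "set_integrable M A f" "norm (LINT x:A|M. f x) \<le> (LINT x:A|M. g x)"
proof -
  have *: "(\<lambda>x. indicator A x *\<^sub>R f x) \<in> borel_measurable M"
    using assms by measurable
  have "AE x in M. norm (indicator A x *\<^sub>R f x) \<le> indicator A x *\<^sub>R g x"
    using assms(4) by (auto simp: indicator_def)
  from dominated_integral[OF * _ this] assms(3)
  show "set_integrable M A f" "norm (LINT x:A|M. f x) \<le> (LINT x:A|M. g x)"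
    by (auto simp: set_integrable_def set_lebesgue_integral_def)
qed

lemma set_integral_exp_tail:
  fixes c T :: real
  assumes "c > 0"
  shows "set_integrable lborel {T..} (\<lambda>t. exp (- (c * t)))"
    and "(LINT t:{T..}|lborel. exp (- (c * t))) = exp (- (c * T)) / c"
proof -
  have lim: "((\<lambda>t. - (exp (- (c * t)) / c)) \<longlongrightarrow> - (0 / c)) at_top"
    by (intro tendsto_intros filterlim_compose[OF exp_at_bot] filterlim_compose[OF filterlim_uminus_at_bot_at_top]
      filterlim_tendsto_pos_mult_at_top[OF tendsto_const \<open>c > 0\<close>] filterlim_ident)
      (use assms in auto)
  have nn: "(\<integral>\<^sup>+x. ennreal (exp (- (c * x))) * indicator {T ..} x \<partial>lborel)
      = - (0 / c) - (- (exp (- (c * T)) / c))"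
    by (rule nn_integral_FTC_atLeast[OF _ _ _ lim])
      (use assms in \<open>auto intro!: derivative_eq_intros simp: field_simps\<close>)
  have "has_bochner_integral lborel (\<lambda>t. indicator {T..} t *\<^sub>R exp (- (c * t))) (exp (- (c * T)) / c)"
  proof (rule has_bochner_integral_nn_integral)
    show "(\<integral>\<^sup>+x. ennreal (indicator {T..} x *\<^sub>R exp (- (c * x))) \<partial>lborel) = ennreal (exp (- (c * T)) / c)"
      using nn by (simp add: ennreal_mult' mult.commute ennreal_indicator)
  qed (use assms in auto)
  then show "set_integrable lborel {T..} (\<lambda>t. exp (- (c * t)))"
    and "(LINT t:{T..}|lborel. exp (- (c * t))) = exp (- (c * T)) / c"
    by (auto simp: set_integrable_def set_lebesgue_integral_def has_bochner_integral_iff)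
qed

lemma integrable_exp_neg_abs:
  fixes c :: real
  assumes "c > 0"
  shows "integrable lborel (\<lambda>x. exp (- (c * \<bar>x\<bar>)))"
proof -
  define e where "e = (\<lambda>x::real. indicator {0..} x *\<^sub>R exp (- (c * x)))"
  have e: "integrable lborel e"
    using set_integral_exp_tail(1)[OF assms, of 0] by (simp add: set_integrable_def e_def)
  have "integrable lborel (\<lambda>x. e x + e (0 + (-1) * x))"
    by (intro Bochner_Integration.integrable_add e lborel_integrable_real_affine) auto
  then show ?thesis
    by (rule Bochner_Integration.integrable_bound)
      (auto simp: e_def indicator_def abs_if)
qed

lemma integrable_compact_support:
  fixes f :: "real \<Rightarrow> real"
  assumes "continuous_on UNIV f" "\<And>x. \<bar>x\<bar> > R \<Longrightarrow> f x = 0"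
  shows "integrable lborel f"
proof -
  have "integrable lborel (\<lambda>x. indicator {-R..R} x *\<^sub>R f x)"
    by (rule borel_integrable_compact) (auto intro: continuous_on_subset assms)
  also have "(\<lambda>x. indicator {-R..R} x *\<^sub>R f x) = f"
    using assms(2) by (force simp: indicator_def)
  finally show ?thesis .
qed

lemma integral_deriv_compact_support:
  fixes f f' :: "real \<Rightarrow> real"
  assumes "\<And>x. (f has_real_derivative f' x) (at x)" "continuous_on UNIV f'"
    and "\<And>x. \<bar>x\<bar> > R \<Longrightarrow> f x = 0"
  shows "(LINT x|lborel. f' x) = 0"
proof -
  \<comment> \<open>Lies strictly beyond \<open>R\<close> and is positive even for negative
    \<open>R\<close>, so both boundary values vanish.\<close>
  define S where "S = \<bar>R\<bar> + 1"
  have f'0: "f' x = 0" if "\<bar>x\<bar> > R" for x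
  proof -
    have "open {y::real. R < \<bar>y\<bar>}"
      by (intro open_Collect_less continuous_intros)
    from eventually_nhds_in_open[OF this, of x] that have "eventually (\<lambda>y. \<bar>y\<bar> > R) (nhds x)"
      by simp
    then have "eventually (\<lambda>y. f y = (\<lambda>_. 0) y) (nhds x)"
      by eventually_elim (use assms(3) in auto)
    then have "(f has_real_derivative 0) (at x)"
      by (subst DERIV_cong_ev[OF refl _ refl]) auto
    with assms(1) show ?thesis by (metis DERIV_unique)
  qed
  have "(LINT x|lborel. f' x) = (LINT x|lborel. f' x * indicator {-S..S} x)"
    by (intro Bochner_Integration.integral_cong) (auto simp: indicator_def S_def intro!: f'0)
  also have "\<dots> = f S - f (-S)"
    by (rule integral_FTC_Icc_real)
      (use assms in \<open>auto simp: S_def continuous_on_eq_continuous_at\<close>)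
  also have "\<dots> = 0" using assms(3)[of S] assms(3)[of "-S"] by (auto simp: S_def)
  finally show ?thesis .
qed

lemma exp_dominated_tail:
  fixes f :: "real \<Rightarrow> 'b::{banach, second_countable_topology}"
  assumes m: "f \<in> borel_measurable borel" and c: "c > 0"
    and A: "\<And>t. t \<ge> T \<Longrightarrow> norm (f t) \<le> A * exp (- (c * t))"
  shows "set_integrable lborel {T..} f"
    and "norm (LINT t:{T..}|lborel. f t) \<le> A * exp (- (c * T)) / c"
proof -
  have int: "set_integrable lborel {T..} (\<lambda>t. A * exp (- (c * t)))"
    by (intro set_integrable_mult_right set_integral_exp_tail c)
  have bd: "norm (f t) \<le> A * exp (- (c * t))" if "t \<in> {T..}" for t
    using that A by simp
  note * = dominated_set_integral[OF _ _ int bd]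
  show "set_integrable lborel {T..} f" by (rule *(1)) (use m in auto)
  have "norm (LINT t:{T..}|lborel. f t) \<le> (LINT t:{T..}|lborel. A * exp (- (c * t)))"
    by (rule *(2)) (use m in auto)
  then show "norm (LINT t:{T..}|lborel. f t) \<le> A * exp (- (c * T)) / c"
    by (simp add: set_integral_exp_tail(2)[OF c])
qed

lemma set_integral_split_tail:
  fixes f :: "real \<Rightarrow> 'b::{banach, second_countable_topology}"
  assumes f: "set_integrable lborel {0..} f" and T: "T \<ge> 0"
  shows "set_integrable lborel {0..T} f"
    and "(LINT t:{0..}|lborel. f t) = (LINT t:{0..T}|lborel. f t) + (LINT t:{T..}|lborel. f t)"
proof -
  show i1: "set_integrable lborel {0..T} f"
    by (rule set_integrable_subset[OF f]) auto
  have i2: "set_integrable lborel {T..} f"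
    by (rule set_integrable_subset[OF f]) (use T in auto)
  have AE: "AE t in lborel. indicator {0..} t *\<^sub>R f t = indicator {0..T} t *\<^sub>R f t + indicator {T..} t *\<^sub>R f t"
    using AE_lborel_singleton[of T] by eventually_elim (use T in \<open>auto simp: indicator_def\<close>)
  have "(LINT t:{0..}|lborel. f t) =
      (LINT t|lborel. indicator {0..T} t *\<^sub>R f t + indicator {T..} t *\<^sub>R f t)"
    unfolding set_lebesgue_integral_def
    using f i1 i2 AE by (intro integral_cong_AE) (auto simp: set_integrable_def)
  also have "\<dots> = (LINT t:{0..T}|lborel. f t) + (LINT t:{T..}|lborel. f t)"
    using i1 i2 by (simp add: set_lebesgue_integral_def set_integrable_def)
  finally show "(LINT t:{0..}|lborel. f t) = (LINT t:{0..T}|lborel. f t) + (LINT t:{T..}|lborel. f t)" .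
qed

lemma set_integral_reflect_Icc:
  fixes f :: "real \<Rightarrow> 'b::{banach, second_countable_topology}"
  shows "(LINT s:{0..t}|lborel. f (t - s)) = (LINT u:{0..t}|lborel. f u)"
proof -
  have "(LINT u:{0..t}|lborel. f u) = (LINT s|lborel. indicator {0..t} (t + (-1) * s) *\<^sub>R f (t + (-1) * s))"
    unfolding set_lebesgue_integral_def
    using lborel_integral_real_affine[of "-1" "\<lambda>u. indicator {0..t} u *\<^sub>R f u" t] by simp
  also have "\<dots> = (LINT s:{0..t}|lborel. f (t - s))"
    unfolding set_lebesgue_integral_def
    by (intro Bochner_Integration.integral_cong) (auto simp: indicator_def)
  finally show ?thesis by simp
qed

lemma integrable_times_lborel:
  fixes e f :: "real \<Rightarrow> real"
  assumes e: "integrable lborel e" and f: "integrable lborel f"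
  shows "integrable (lborel \<Otimes>\<^sub>M lborel) (\<lambda>(x, y). e x * f y)"
proof (rule lborel_pair.Fubini_integrable)
  have [measurable]: "e \<in> borel_measurable borel" "f \<in> borel_measurable borel"
    using e f by (auto dest: borel_measurable_integrable)
  show "(\<lambda>(x, y). e x * f y) \<in> borel_measurable (lborel \<Otimes>\<^sub>M lborel)" by measurable
  show "integrable lborel (\<lambda>x. LINT y|lborel. norm (case (x, y) of (x, y) \<Rightarrow> e x * f y))"
    using e by (simp add: abs_mult)
  show "AE x in lborel. integrable lborel (\<lambda>y. case (x, y) of (x, y) \<Rightarrow> e x * f y)"
    using f by simp
qed

lemma integrable_indicator_Icc: "integrable lborel (indicator {a..b::real} :: real \<Rightarrow> real)"
  using integrable_real_indicator[of "{a..b}" lborel] emeasure_lborel_Icc_eq[of a b] by auto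

text \<open>Integrating a convolution in time replaces the kernel by its primitive. This is the step
  by which \<open>k\<close> later gives way to its tail integral.\<close>

lemma convolution_Fubini:
  fixes k b :: "real \<Rightarrow> real"
  assumes [measurable]: "k \<in> borel_measurable borel" "b \<in> borel_measurable borel"
    and k: "\<And>u. u \<in> {0..T} \<Longrightarrow> \<bar>k u\<bar> \<le> Bk" and b: "\<And>u. u \<in> {0..T} \<Longrightarrow> \<bar>b u\<bar> \<le> Bb"
  shows "set_integrable lborel {0..T} (\<lambda>t. LINT s:{0..t}|lborel. k (t - s) * b s)"
    and "(LINT t:{0..T}|lborel. LINT s:{0..t}|lborel. k (t - s) * b s) =
         (LINT s:{0..T}|lborel. (LINT u:{0..T - s}|lborel. k u) * b s)"
proof -
  \<comment> \<open>The condition on s is a conditional and not an indicator of {0..t}: that set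
    varies with t, and joint measurability in (t, s) is needed.\<close>
  define F where "F = (\<lambda>t s. indicator {0..T} t * (if 0 \<le> s \<and> s \<le> t then 1 else 0) * (k (t - s) * b s))"
  have int: "integrable (lborel \<Otimes>\<^sub>M lborel) (case_prod F)"
  proof (rule dominated_integral(1))
    show "case_prod F \<in> borel_measurable (lborel \<Otimes>\<^sub>M lborel)"
      unfolding F_def by measurable
    show "integrable (lborel \<Otimes>\<^sub>M lborel) (\<lambda>(t, s). (Bk * indicator {0..T} t) * (Bb * indicator {0..T} s))"
      by (intro integrable_times_lborel integrable_mult_right integrable_indicator_Icc)
    have "norm (F t s) \<le> (Bk * indicator {0..T} t) * (Bb * indicator {0..T} s)" for t s
    proof (cases "t \<in> {0..T} \<and> 0 \<le> s \<and> s \<le> t")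
      case True
      then have "\<bar>k (t - s)\<bar> * \<bar>b s\<bar> \<le> Bk * Bb"
        by (intro mult_mono k b order_trans[OF abs_ge_zero k[of t]]) auto
      with True show ?thesis by (simp add: F_def abs_mult)
    next
      case False
      moreover have "0 \<le> (Bk * indicator {0..T} t) * (Bb * indicator {0..T} s)"
        using order_trans[OF abs_ge_zero k[of t]] order_trans[OF abs_ge_zero b[of s]]
        by (auto simp: indicator_def)
      ultimately show ?thesis by (auto simp: F_def indicator_def)
    qed
    then show "AE x in lborel \<Otimes>\<^sub>M lborel. norm (case_prod F x) \<le>
        (case x of (t, s) \<Rightarrow> (Bk * indicator {0..T} t) * (Bb * indicator {0..T} s))"
      by auto
  qed
  have inner: "(LINT s|lborel. F t s) = indicator {0..T} t *\<^sub>R (LINT s:{0..t}|lborel. k (t - s) * b s)" for t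
  proof -
    have "(LINT s|lborel. F t s) = (LINT s|lborel. indicator {0..T} t * (indicator {0..t} s *\<^sub>R (k (t - s) * b s)))"
      by (intro Bochner_Integration.integral_cong) (auto simp: F_def indicator_def)
    then show ?thesis by (simp add: set_lebesgue_integral_def)
  qed
  show "set_integrable lborel {0..T} (\<lambda>t. LINT s:{0..t}|lborel. k (t - s) * b s)"
    using lborel_pair.integrable_fst[OF int] by (simp add: set_integrable_def inner)
  have outer: "(LINT t|lborel. F t s) = indicator {0..T} s *\<^sub>R ((LINT u:{0..T - s}|lborel. k u) * b s)" for s
  proof -
    have "(LINT t|lborel. F t s) = (LINT u|lborel. F (s + 1 * u) s)"
      using lborel_integral_real_affine[of 1 "\<lambda>t. F t s" s] by simp
    also have "\<dots> = (LINT u|lborel. (indicator {0..T - s} u *\<^sub>R k u) * (indicator {0..T} s * b s))"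
      by (intro Bochner_Integration.integral_cong) (auto simp: F_def indicator_def)
    also have "\<dots> = (LINT u:{0..T - s}|lborel. k u) * (indicator {0..T} s * b s)"
      unfolding set_lebesgue_integral_def by (rule integral_mult_left_zero)
    finally show ?thesis by (simp add: mult_ac)
  qed
  show "(LINT t:{0..T}|lborel. LINT s:{0..t}|lborel. k (t - s) * b s) =
         (LINT s:{0..T}|lborel. (LINT u:{0..T - s}|lborel. k u) * b s)"
    using lborel_pair.Fubini_integral[OF int] by (simp add: inner outer set_lebesgue_integral_def)
qed

lemma exp_convolution_le:
  fixes \<delta> :: real
  assumes "\<delta> > 0" "t \<ge> 0"
  shows "set_integrable lborel {0..t} (\<lambda>s. exp (- (\<delta> * (t - s))))"
    and "(LINT s:{0..t}|lborel. exp (- (\<delta> * (t - s)))) \<le> 1 / \<delta>"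
proof -
  show "set_integrable lborel {0..t} (\<lambda>s. exp (- (\<delta> * (t - s))))"
    by (intro borel_integrable_atLeastAtMost' continuous_intros)
  have "(LINT s:{0..t}|lborel. exp (- (\<delta> * (t - s)))) = (LINT u:{0..t}|lborel. exp (- (\<delta> * u)))"
    by (rule set_integral_reflect_Icc)
  also have "\<dots> = 1 / \<delta> - exp (- (\<delta> * t)) / \<delta>"
    using set_integral_split_tail(2)[OF set_integral_exp_tail(1)[OF assms(1)] assms(2)]
    by (simp add: set_integral_exp_tail(2)[OF assms(1)])
  also have "\<dots> \<le> 1 / \<delta>" using assms by simp
  finally show "(LINT s:{0..t}|lborel. exp (- (\<delta> * (t - s)))) \<le> 1 / \<delta>" .
qed

text \<open>A maximum argument takes the place of a resolvent kernel. At the point of [0, T] where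
  exp (\<mu> t) |c t| is largest, the convolution is at most \<epsilon> / \<delta> \<le> 1/2 of that
  maximum and is absorbed on the left. The surplus \<delta> of the kernel's decay over the claimed
  rate makes the weighted kernel integrable; the resulting constant does not depend on
  \<open>T\<close>.\<close>

lemma convolution_equation_decay:
  fixes c F \<kappa> :: "real \<Rightarrow> real"
  assumes \<delta>: "\<delta> > 0" "\<epsilon> \<le> \<delta> / 2"
    and c: "continuous_on UNIV c"
    and [measurable]: "\<kappa> \<in> borel_measurable borel"
    and \<kappa>: "\<And>u. u \<ge> 0 \<Longrightarrow> \<bar>\<kappa> u\<bar> \<le> \<epsilon> * exp (- ((\<mu> + \<delta>) * u))"
    and F: "\<And>t. t \<ge> 0 \<Longrightarrow> \<bar>F t\<bar> \<le> A * exp (- (\<mu> * t))"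
    and eq: "\<And>t. t \<ge> 0 \<Longrightarrow> c t = F t + (LINT s:{0..t}|lborel. \<kappa> (t - s) * c s)"
    and T: "T \<ge> 0"
  shows "\<bar>c T\<bar> \<le> 2 * A * exp (- (\<mu> * T))"
proof -
  have \<epsilon>0: "\<epsilon> \<ge> 0" using \<kappa>[of 0] by simp
  have [measurable]: "c \<in> borel_measurable borel" by (intro borel_measurable_continuous_onI c)
  have "\<exists>x\<in>{0..T}. \<forall>y\<in>{0..T}. exp (\<mu> * y) * \<bar>c y\<bar> \<le> exp (\<mu> * x) * \<bar>c x\<bar>"
    by (rule continuous_attains_sup) (use T in \<open>auto intro!: continuous_intros continuous_on_subset[OF c]\<close>)
  then obtain x where x: "x \<in> {0..T}" and max: "\<And>y. y \<in> {0..T} \<Longrightarrow> exp (\<mu> * y) * \<bar>c y\<bar> \<le> exp (\<mu> * x) * \<bar>c x\<bar>"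
    by blast
  define m where "m = exp (\<mu> * x) * \<bar>c x\<bar>"
  have m0: "m \<ge> 0" by (simp add: m_def)
  have cy: "\<bar>c y\<bar> \<le> m * exp (- (\<mu> * y))" if "y \<in> {0..T}" for y
    using max[OF that] by (simp add: m_def exp_minus field_simps)
  have "\<bar>LINT s:{0..x}|lborel. \<kappa> (x - s) * c s\<bar> \<le> (LINT s:{0..x}|lborel. \<epsilon> * m * exp (- (\<mu> * x)) * exp (- (\<delta> * (x - s))))"
    unfolding real_norm_def[symmetric]
  proof (rule dominated_set_integral(2))
    show "set_integrable lborel {0..x} (\<lambda>s. \<epsilon> * m * exp (- (\<mu> * x)) * exp (- (\<delta> * (x - s))))"
      using x by (intro set_integrable_mult_right exp_convolution_le \<delta>) auto
    fix s assume s: "s \<in> {0..x}"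
    have "\<bar>\<kappa> (x - s)\<bar> * \<bar>c s\<bar> \<le> (\<epsilon> * exp (- ((\<mu> + \<delta>) * (x - s)))) * (m * exp (- (\<mu> * s)))"
      by (intro mult_mono \<kappa> cy) (use s x \<epsilon>0 in auto)
    also have "\<dots> = \<epsilon> * m * (exp (- ((\<mu> + \<delta>) * (x - s))) * exp (- (\<mu> * s)))"
      by (simp add: mult_ac)
    also have "exp (- ((\<mu> + \<delta>) * (x - s))) * exp (- (\<mu> * s)) = exp (- (\<mu> * x)) * exp (- (\<delta> * (x - s)))"
      by (simp add: algebra_simps flip: exp_add)
    finally show "norm (\<kappa> (x - s) * c s) \<le> \<epsilon> * m * exp (- (\<mu> * x)) * exp (- (\<delta> * (x - s)))"
      by (simp add: abs_mult mult.assoc)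
  qed auto
  also have "\<dots> = \<epsilon> * m * exp (- (\<mu> * x)) * (LINT s:{0..x}|lborel. exp (- (\<delta> * (x - s))))"
    by simp
  also have "\<dots> \<le> \<epsilon> * m * exp (- (\<mu> * x)) * (1 / \<delta>)"
    using x \<epsilon>0 m0 by (intro mult_left_mono exp_convolution_le \<delta>) auto
  also have "\<dots> = (\<epsilon> / \<delta>) * (m * exp (- (\<mu> * x)))" by simp
  also have "\<dots> \<le> (1 / 2) * (m * exp (- (\<mu> * x)))"
    using \<delta> m0 by (intro mult_right_mono) (auto simp: field_simps)
  finally have "\<bar>c x\<bar> \<le> A * exp (- (\<mu> * x)) + (1 / 2) * (m * exp (- (\<mu> * x)))"
    using F[of x] eq[of x] x by auto
  then have "exp (\<mu> * x) * \<bar>c x\<bar> \<le> exp (\<mu> * x) * (A * exp (- (\<mu> * x)) + (1 / 2) * (m * exp (- (\<mu> * x))))"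
    by (intro mult_left_mono) auto
  also have "\<dots> = A + m / 2" by (simp add: exp_minus field_simps)
  finally have "m \<le> 2 * A" by (simp add: m_def)
  then have "m * exp (- (\<mu> * T)) \<le> 2 * A * exp (- (\<mu> * T))" by (intro mult_right_mono) auto
  moreover have "\<bar>c T\<bar> \<le> m * exp (- (\<mu> * T))" using T by (intro cy) auto
  ultimately show ?thesis by linarith
qed

section \<open>Laplace transforms of exponentially bounded functions\<close>

lemma laplace_integrand_bound:
  assumes "\<bar>k t\<bar> \<le> A * exp (- (c * t))"
  shows "norm (exp (- z * of_real t) * complex_of_real (k t)) \<le> A * exp (- ((c + Re z) * t))"
proof -
  have "norm (exp (- z * of_real t) * complex_of_real (k t)) = exp (- (Re z * t)) * \<bar>k t\<bar>"
    by (simp add: norm_mult)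
  also have "\<dots> \<le> exp (- (Re z * t)) * (A * exp (- (c * t)))"
    by (intro mult_left_mono assms) auto
  also have "\<dots> = A * exp (- ((c + Re z) * t))"
    by (simp add: algebra_simps flip: exp_add)
  finally show ?thesis .
qed

lemma laplace_tail:
  fixes k :: "real \<Rightarrow> real"
  assumes [measurable]: "k \<in> borel_measurable borel"
    and A: "\<And>t. t \<ge> T \<Longrightarrow> \<bar>k t\<bar> \<le> A * exp (- (c * t))"
    and z: "c + Re z > 0"
  shows "set_integrable lborel {T..} (\<lambda>t. exp (- z * of_real t) * complex_of_real (k t))"
    and "cmod (LINT t:{T..}|lborel. exp (- z * of_real t) * of_real (k t)) \<le> A * exp (- ((c + Re z) * T)) / (c + Re z)"
proof -
  have b: "norm (exp (- z * of_real t) * complex_of_real (k t)) \<le> A * exp (- ((c + Re z) * t))" if "t \<ge> T" for t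
    using A[OF that] by (rule laplace_integrand_bound)
  have m: "(\<lambda>t. exp (- z * of_real t) * complex_of_real (k t)) \<in> borel_measurable borel" by measurable
  note * = exp_dominated_tail[OF m z b]
  show "set_integrable lborel {T..} (\<lambda>t. exp (- z * of_real t) * complex_of_real (k t))"
    by (rule *(1))
  show "cmod (LINT t:{T..}|lborel. exp (- z * of_real t) * of_real (k t)) \<le> A * exp (- ((c + Re z) * T)) / (c + Re z)"
    by (rule *(2))
qed

text \<open>The first-order Taylor remainder of exp (- h t) is at most |h|^2 t^2 exp (|Re h| t).
  Against the exponentially decaying integrand this is integrable, so the error of the difference
  quotient is O(|h|).\<close>

lemma laplace_has_derivative:
  fixes k :: "real \<Rightarrow> real"
  assumes [measurable]: "k \<in> borel_measurable borel"
    and A: "\<And>t. t \<ge> 0 \<Longrightarrow> \<bar>k t\<bar> \<le> A * exp (- (c * t))"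
    and z: "c + Re z > 0"
  shows "((\<lambda>z. LINT t:{0..}|lborel. exp (- z * of_real t) * complex_of_real (k t)) has_field_derivative
      (LINT t:{0..}|lborel. exp (- z * of_real t) * complex_of_real (- t * k t))) (at z)"
proof -
  \<comment> \<open>The available decay is divided by three: one share absorbs t^2, one absorbs exp
    (|Re h| t), and the last keeps the integral finite.\<close>
  define \<epsilon> where "\<epsilon> = (c + Re z) / 3"
  have \<epsilon>: "\<epsilon> > 0" using z by (simp add: \<epsilon>_def)
  have A0: "A \<ge> 0" using A[of 0] by simp
  define F where "F = (\<lambda>z. LINT t:{0..}|lborel. exp (- z * of_real t) * complex_of_real (k t))"
  define D where "D = (LINT t:{0..}|lborel. exp (- z * of_real t) * complex_of_real (- t * k t))"
  have sq: "t\<^sup>2 \<le> 2 / \<epsilon>\<^sup>2 * exp (\<epsilon> * t)" if "t \<ge> 0" for t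
  proof -
    have "1 + \<epsilon> * t + (\<epsilon> * t)\<^sup>2 / 2 \<le> exp (\<epsilon> * t)"
      using that \<epsilon> by (intro exp_lower_Taylor_quadratic) auto
    moreover have "0 \<le> \<epsilon> * t" using that \<epsilon> by simp
    ultimately have "(\<epsilon> * t)\<^sup>2 / 2 \<le> exp (\<epsilon> * t)" by linarith
    then show ?thesis using \<epsilon> by (simp add: field_simps power_mult_distrib)
  qed
  have lin: "t \<le> 1 / \<epsilon> * exp (\<epsilon> * t)" for t
  proof -
    have "\<epsilon> * t \<le> exp (\<epsilon> * t)" using exp_ge_add_one_self[of "\<epsilon> * t"] by linarith
    with \<epsilon> show ?thesis by (simp add: field_simps)
  qed
  have iF: "set_integrable lborel {0..} (\<lambda>t. exp (- w * of_real t) * complex_of_real (k t))" if "c + Re w > 0" for w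
    by (rule laplace_tail(1)[OF _ A that]) auto
  have iD: "set_integrable lborel {0..} (\<lambda>t. exp (- z * of_real t) * complex_of_real (- t * k t))"
  proof (rule laplace_tail(1)[where A="A * (1 / \<epsilon>)" and c="c - \<epsilon>"])
    fix t :: real assume "0 \<le> t"
    then have "\<bar>- t * k t\<bar> \<le> (1 / \<epsilon> * exp (\<epsilon> * t)) * (A * exp (- (c * t)))"
      unfolding abs_mult by (intro mult_mono A) (use lin \<epsilon> in auto)
    then show "\<bar>- t * k t\<bar> \<le> A * (1 / \<epsilon>) * exp (- ((c - \<epsilon>) * t))"
      by (simp add: algebra_simps exp_diff exp_minus field_simps)
  next
    have "c - \<epsilon> + Re z = 2 * \<epsilon>" by (simp add: \<epsilon>_def field_simps)
    with \<epsilon> show "c - \<epsilon> + Re z > 0" by simp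
  qed auto
  define S where "S = A * (2 / \<epsilon>\<^sup>2) * (1 / \<epsilon>)"
  have est: "cmod ((F (z + h) - F z) / h - D) \<le> cmod h * S" if h: "h \<noteq> 0" "cmod h < \<epsilon>" for h
  proof -
    have reh: "\<bar>Re h\<bar> < \<epsilon>" using h abs_Re_le_cmod[of h] by linarith
    define w where "w = (\<lambda>t. exp (- (z + h) * of_real t) * complex_of_real (k t) - exp (- z * of_real t) * complex_of_real (k t)
       - h * (exp (- z * of_real t) * complex_of_real (- t * k t)))"
    have i1: "set_integrable lborel {0..} (\<lambda>t. exp (- (z + h) * of_real t) * complex_of_real (k t))"
      by (rule iF) (use reh \<epsilon> in \<open>auto simp: \<epsilon>_def\<close>)
    have "F (z + h) - F z - h * D = (LINT t:{0..}|lborel. w t)"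
      unfolding w_def F_def D_def set_integral_mult_right[symmetric]
      by (simp only: set_integral_diff set_integrable_mult_right iD i1 iF[OF z])
    also have "cmod \<dots> \<le> (LINT t:{0..}|lborel. (cmod h)\<^sup>2 * (A * (2 / \<epsilon>\<^sup>2)) * exp (- (\<epsilon> * t)))"
    proof (rule dominated_set_integral(2))
      show "set_integrable lborel {0..} (\<lambda>t. (cmod h)\<^sup>2 * (A * (2 / \<epsilon>\<^sup>2)) * exp (- (\<epsilon> * t)))"
        by (intro set_integrable_mult_right set_integral_exp_tail \<epsilon>)
      show "w \<in> borel_measurable lborel" unfolding w_def by measurable
      fix t :: real assume "t \<in> {0..}"
      then have t: "t \<ge> 0" by simp
      have w: "w t = exp (- z * of_real t) * of_real (k t) * (exp (- h * of_real t) - (\<Sum>i\<le>1. (- h * of_real t) ^ i / fact i))"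
        by (simp add: w_def algebra_simps exp_add[symmetric] exp_diff exp_minus field_simps)
      have "cmod (exp (- h * of_real t) - (\<Sum>i\<le>1. (- h * of_real t) ^ i / fact i)) \<le>
         exp \<bar>Re (- h * of_real t)\<bar> * (cmod (- h * of_real t)) ^ Suc 1 / fact 1"
        by (rule Taylor_exp)
      also have "\<dots> = exp (\<bar>Re h\<bar> * t) * ((cmod h)\<^sup>2 * t\<^sup>2)"
        using t by (simp add: norm_mult abs_mult power2_eq_square mult_ac)
      also have "\<dots> \<le> exp (\<epsilon> * t) * ((cmod h)\<^sup>2 * (2 / \<epsilon>\<^sup>2 * exp (\<epsilon> * t)))"
        using t reh by (intro mult_mono mult_left_mono sq) (auto intro!: mult_right_mono)
      finally have 1: "cmod (exp (- h * of_real t) - (\<Sum>i\<le>1. (- h * of_real t) ^ i / fact i)) \<le> \<dots>" .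
      have "cmod (w t) \<le> (A * exp (- ((c + Re z) * t))) * (exp (\<epsilon> * t) * ((cmod h)\<^sup>2 * (2 / \<epsilon>\<^sup>2 * exp (\<epsilon> * t))))"
        unfolding w norm_mult[of "_ * of_real (k t)"]
        by (intro mult_mono laplace_integrand_bound A t 1) (use A0 in auto)
      also have "\<dots> = (cmod h)\<^sup>2 * (A * (2 / \<epsilon>\<^sup>2)) * (exp (- ((c + Re z) * t)) * exp (\<epsilon> * t) * exp (\<epsilon> * t))"
        by (simp add: mult_ac)
      also have "exp (- ((c + Re z) * t)) * exp (\<epsilon> * t) * exp (\<epsilon> * t) = exp (- (\<epsilon> * t))"
        by (simp add: \<epsilon>_def algebra_simps flip: exp_add)
      finally show "cmod (w t) \<le> (cmod h)\<^sup>2 * (A * (2 / \<epsilon>\<^sup>2)) * exp (- (\<epsilon> * t))" .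
    qed auto
    also have "\<dots> = (cmod h)\<^sup>2 * S"
      by (simp add: set_integral_exp_tail(2)[OF \<epsilon>] S_def)
    finally have 2: "cmod (F (z + h) - F z - h * D) \<le> (cmod h)\<^sup>2 * S" .
    have "(F (z + h) - F z) / h - D = (F (z + h) - F z - h * D) / h"
      using h by (simp add: field_simps)
    then have "cmod ((F (z + h) - F z) / h - D) = cmod (F (z + h) - F z - h * D) / cmod h"
      by (simp add: norm_divide)
    also have "\<dots> \<le> (cmod h)\<^sup>2 * S / cmod h"
      by (intro divide_right_mono 2) auto
    finally show ?thesis using h by (simp add: power2_eq_square)
  qed
  have "((\<lambda>h. (F (z + h) - F z) / h - D) \<longlongrightarrow> 0) (at 0)"
  proof (rule Lim_null_comparison)
    show "\<forall>\<^sub>F h in at 0. cmod ((F (z + h) - F z) / h - D) \<le> cmod h * S"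
      using eventually_at_ball[OF \<epsilon>, of 0 UNIV] eventually_neq_at_within[of 0 0 UNIV]
      by eventually_elim (use est in auto)
    show "((\<lambda>h. cmod h * S) \<longlongrightarrow> 0) (at 0)"
      by (intro tendsto_eq_intros) auto
  qed
  then show ?thesis
    unfolding F_def[symmetric] D_def[symmetric] DERIV_def by (simp add: LIM_zero_iff)
qed

section \<open>Lipschitz bounds from weak derivatives\<close>

text \<open>The test functions are continuous truncated approximations of the negative part of \<open>f\<close>.\<close>

lemma AE_nonneg_of_test_functions:
  fixes f :: "real \<Rightarrow> real"
  assumes f[measurable]: "f \<in> borel_measurable lborel" and C: "AE x in lborel. \<bar>f x\<bar> \<le> C"
    and test: "\<And>u R. continuous_on UNIV u \<Longrightarrow> (\<And>x. u x \<ge> 0) \<Longrightarrow> (\<And>x. \<bar>x\<bar> > R \<Longrightarrow> u x = 0) \<Longrightarrow>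
       (LINT x|lborel. f x * u x) \<ge> 0"
  shows "AE x in lborel. f x \<ge> 0"
proof -
  have "f measurable_on UNIV"
    by (rule lebesgue_measurable_imp_measurable_on) (use f in \<open>auto intro: measurable_completion\<close>)
  then obtain N g where N: "negligible N" and g: "\<And>n. continuous_on UNIV (g n)"
    and lim: "\<And>x. x \<notin> N \<Longrightarrow> (\<lambda>n. g n x) \<longlonglongrightarrow> f x"
    unfolding measurable_on_def by auto
  have [measurable]: "g n \<in> borel_measurable borel" for n
    by (intro borel_measurable_continuous_onI g)
  have AEN: "AE x in lborel. x \<notin> N"
    using N unfolding negligible_iff_null_sets
    by (metis AE_completion_iff AE_not_in)
  have "AE x in lborel. \<bar>x\<bar> < real R \<longrightarrow> f x \<ge> 0" for R :: nat
  proof -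
    \<comment> \<open>A continuous cutoff that is positive exactly where |x| <
      \<open>R\<close>.\<close>
    define cut where "cut = (\<lambda>x::real. max 0 (min 1 (real R - \<bar>x\<bar>)))"
    have cut: "continuous_on UNIV cut" "\<And>x. 0 \<le> cut x" "\<And>x. \<bar>x\<bar> > real R \<Longrightarrow> cut x = 0"
      unfolding cut_def by (auto intro!: continuous_intros)
    have [measurable]: "cut \<in> borel_measurable borel"
      by (intro borel_measurable_continuous_onI cut)
    have icut: "integrable lborel cut" by (rule integrable_compact_support[OF cut(1,3)])
    \<comment> \<open>Clipping at \<open>C\<close> gives a bound uniform in n for dominated
      convergence. It costs nothing in the limit, since - f x \<le> \<open>C\<close> almost
      everywhere.\<close>
    define u where "u = (\<lambda>n x. max 0 (min C (- g n x)) * cut x)"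
    define v where "v = (\<lambda>x. max 0 (min C (- f x)) * cut x)"
    have C0: "C \<ge> 0"
    proof (rule ccontr)
      assume "\<not> C \<ge> 0"
      with C have "AE x::real in lborel. False" by (auto elim: eventually_mono)
      then show False
        by (simp add: ae_filter_eq_bot_iff)
    qed
    have conv: "(\<lambda>n. LINT x|lborel. f x * u n x) \<longlonglongrightarrow> (LINT x|lborel. f x * v x)"
    proof (rule integral_dominated_convergence)
      show "AE x in lborel. (\<lambda>n. f x * u n x) \<longlonglongrightarrow> f x * v x"
        using AEN by eventually_elim (auto simp: u_def v_def intro!: tendsto_intros lim)
      show "AE x in lborel. norm (f x * u n x) \<le> C * C * cut x" for n
        using C by eventually_elim
          (use cut(2) C0 in \<open>auto simp: u_def abs_mult mult.assoc[symmetric] intro!: mult_right_mono mult_mono\<close>)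
      show "integrable lborel (\<lambda>x. C * C * cut x)" using icut by simp
      show "(\<lambda>x. f x * v x) \<in> borel_measurable lborel" unfolding v_def by measurable
      show "(\<lambda>x. f x * u n x) \<in> borel_measurable lborel" for n unfolding u_def by measurable
    qed
    have "(LINT x|lborel. f x * u n x) \<ge> 0" for n
    proof (rule test[where R="real R"])
      show "continuous_on UNIV (u n)"
        unfolding u_def by (intro continuous_intros g cut(1))
      show "u n x \<ge> 0" for x
        unfolding u_def by (intro mult_nonneg_nonneg cut(2)) simp
      show "u n x = 0" if "\<bar>x\<bar> > real R" for x
        unfolding u_def using cut(3)[OF that] by simp
    qed
    with conv have ge: "(LINT x|lborel. f x * v x) \<ge> 0"
      by (intro LIMSEQ_le_const) auto
    have int: "integrable lborel (\<lambda>x. - (f x * v x))"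
    proof (rule Bochner_Integration.integrable_bound)
      show "integrable lborel (\<lambda>x. C * C * cut x)" using icut by simp
      show "AE x in lborel. norm (- (f x * v x)) \<le> norm (C * C * cut x)"
        using C by eventually_elim
          (use cut(2) C0 in \<open>auto simp: v_def abs_mult mult.assoc[symmetric] intro!: mult_right_mono mult_mono\<close>)
    qed (unfold v_def, measurable)
    \<comment> \<open>The integrand f v has a sign opposite to that of its integral, so it vanishes
      almost everywhere; but v is positive wherever f is negative and |x| <
      \<open>R\<close>.\<close>
    have nn: "AE x in lborel. 0 \<le> - (f x * v x)"
      using C
    proof eventually_elim
      case (elim x)
      have "0 \<le> (- f x) * max 0 (min C (- f x))"
        using elim by (cases "f x \<ge> 0") auto
      with cut(2)[of x] show ?case by (simp add: v_def mult.assoc[symmetric] mult_nonneg_nonneg mult_nonpos_nonneg)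
    qed
    have "(LINT x|lborel. - (f x * v x)) = 0"
      using ge integral_nonneg_AE[OF nn] by simp
    then have "AE x in lborel. - (f x * v x) = 0"
      using integral_nonneg_eq_0_iff_AE[OF int nn] by blast
    with C show ?thesis
    proof eventually_elim
      case (elim x)
      show ?case
      proof (intro impI, rule ccontr)
        assume x: "\<bar>x\<bar> < real R" and "\<not> 0 \<le> f x"
        then have "v x > 0" using elim(1) by (auto simp: v_def cut_def intro!: mult_neg_pos)
        with elim(2) \<open>\<not> 0 \<le> f x\<close> show False by auto
      qed
    qed
  qed
  then have "AE x in lborel. \<forall>R::nat. \<bar>x\<bar> < real R \<longrightarrow> f x \<ge> 0"
    unfolding AE_all_countable by blast
  then show ?thesis
    by eventually_elim (use reals_Archimedean2 in blast)
qed

lemma AE_shift: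
  fixes P :: "real \<Rightarrow> bool"
  assumes "AE x in lborel. P x" "Measurable.pred borel P"
  shows "AE x in lborel. P (x + t)"
  using AE_borel_affine[of 1 P t] assms by (simp add: add.commute)

text \<open>Tested against u \<ge> 0, the difference h(x + t) - h(x) moves onto u, and u(x) - u(x -
  t) is the derivative of a nonnegative test function of mass t \<integral> u. The pairing is thus
  at most M t \<integral> u, and \<open>AE_nonneg_of_test_functions\<close>, applied to M t minus
  and plus the difference, turns this into a bound almost everywhere. No continuous representative
  of h has to be constructed.\<close>

lemma weak_derivative_bound_imp_AE_lipschitz:
  fixes h g :: "real \<Rightarrow> real"
  assumes h[measurable]: "h \<in> borel_measurable borel" and C: "AE x in lborel. \<bar>h x\<bar> \<le> C"
    and g[measurable]: "g \<in> borel_measurable borel" and M: "AE x in lborel. \<bar>g x\<bar> \<le> M"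
    and weak: "weak_derivative h g" and t: "t > 0"
  shows "AE x in lborel. \<bar>h (x + t) - h x\<bar> \<le> M * t"
proof -
  have test: "\<bar>LINT x|lborel. (h (x + t) - h x) * u x\<bar> \<le> M * t * (LINT x|lborel. u x)"
    and int1: "integrable lborel (\<lambda>x. (h (x + t) - h x) * u x)" and int2: "integrable lborel u"
    if u: "continuous_on UNIV u" "\<And>x. u x \<ge> 0" "\<And>x. \<bar>x\<bar> > R \<Longrightarrow> u x = 0" for u R
  proof -
    have [measurable]: "u \<in> borel_measurable borel"
      by (intro borel_measurable_continuous_onI u)
    obtain U where U: "\<And>x. (U has_vector_derivative u x) (at x)"
      using einterval_antiderivative[of "-\<infinity>" \<infinity> u] u(1) by (auto simp: continuous_on_eq_continuous_at)
    have U: "(U has_real_derivative u x) (at x)" for x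
      using U by (simp add: has_real_derivative_iff_has_vector_derivative)
    \<comment> \<open>\<open>\<Phi> x\<close> is the integral of \<open>u\<close> over \<open>[x - t, x]\<close>, an admissible test function.\<close>
    define \<Phi> where "\<Phi> = (\<lambda>x. U x - U (x - t))"
    have d\<Phi>: "(\<Phi> has_real_derivative (u x - u (x - t))) (at x)" for x
    proof -
      have "((\<lambda>x. U (x - t)) has_real_derivative u (x - t) * 1) (at x)"
        by (rule DERIV_chain2[OF U]) (auto intro!: derivative_eq_intros)
      then show ?thesis unfolding \<Phi>_def by (auto intro!: derivative_eq_intros U)
    qed
    \<comment> \<open>One mean value point in the window yields both the compact support and the
      sign of \<Phi>.\<close>
    have mvt: "\<exists>\<xi>. x - t < \<xi> \<and> \<xi> < x \<and> \<Phi> x = t * u \<xi>" for x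
      using MVT2[of "x - t" x U u] t U by (auto simp: \<Phi>_def)
    have \<Phi>0: "\<Phi> x = 0" if "\<bar>x\<bar> > \<bar>R\<bar> + t" for x
    proof -
      obtain \<xi> where "x - t < \<xi>" "\<xi> < x" "\<Phi> x = t * u \<xi>" using mvt by blast
      with u(3)[of \<xi>] that t show ?thesis by auto
    qed
    have \<Phi>nn: "\<Phi> x \<ge> 0" for x using mvt[of x] t u(2) by auto
    have c\<Phi>: "continuous_on UNIV \<Phi>"
      using d\<Phi> by (auto simp: continuous_on_eq_continuous_at intro: DERIV_isCont)
    have i\<Phi>: "integrable lborel \<Phi>" by (rule integrable_compact_support[OF c\<Phi> \<Phi>0])
    have [measurable]: "\<Phi> \<in> borel_measurable borel"
      by (intro borel_measurable_continuous_onI c\<Phi>)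
    have us: "continuous_on UNIV (\<lambda>x. u (x - t))"
      by (rule continuous_on_compose2[OF u(1)]) (auto intro!: continuous_intros)
    show iu: "integrable lborel u" by (rule integrable_compact_support[OF u(1,3)])
    have ixu: "integrable lborel (\<lambda>x. x * u x)"
      by (rule integrable_compact_support[where R=R]) (auto intro!: continuous_intros u)
    have ixu': "integrable lborel (\<lambda>x. (x + t) * u x)"
      using ixu iu by (simp add: distrib_right)
    have shift: "(LINT x|lborel. F (x - t)) = (LINT x|lborel. F x)" for F :: "real \<Rightarrow> real"
      using lborel_integral_real_affine[of 1 F "-t"] by simp
    have shift_int: "integrable lborel (\<lambda>x. F (x - t))" if "integrable lborel F" for F :: "real \<Rightarrow> real"
      using lborel_integrable_real_affine[of F 1 "-t"] that by simp
    \<comment> \<open>Obtained by integrating the derivative of x \<Phi>(x) and translating by t, in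
      place of a Fubini argument for the window integral.\<close>
    have mass: "(LINT x|lborel. \<Phi> x) = t * (LINT x|lborel. u x)"
    proof -
      have i': "integrable lborel (\<lambda>x. x * u (x - t))"
        using shift_int[OF ixu'] by simp
      have "(LINT x|lborel. \<Phi> x + (x * u x - x * u (x - t))) = 0"
      proof (rule integral_deriv_compact_support[where f="\<lambda>x. x * \<Phi> x" and R="\<bar>R\<bar> + t"])
        show "((\<lambda>x. x * \<Phi> x) has_real_derivative \<Phi> x + (x * u x - x * u (x - t))) (at x)" for x
          by (rule derivative_eq_intros refl d\<Phi>)+ (simp add: algebra_simps)
      qed (use \<Phi>0 in \<open>auto intro!: continuous_intros u us c\<Phi>\<close>)
      then have "(LINT x|lborel. \<Phi> x) + ((LINT x|lborel. x * u x) - (LINT x|lborel. x * u (x - t))) = 0"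
        using i\<Phi> ixu i' by simp
      moreover have "(LINT x|lborel. x * u (x - t)) = (LINT x|lborel. (x + t) * u x)"
        using shift[of "\<lambda>x. (x + t) * u x"] by simp
      moreover have "(LINT x|lborel. (x + t) * u x) = (LINT x|lborel. x * u x) + t * (LINT x|lborel. u x)"
        using ixu iu by (simp add: distrib_right)
      ultimately show ?thesis by simp
    qed
    have hu: "integrable lborel (\<lambda>x. h x * u x)"
    proof (rule dominated_integral)
      show "integrable lborel (\<lambda>x. C * u x)" using iu by simp
      show "AE x in lborel. norm (h x * u x) \<le> C * u x"
        using C by eventually_elim (use u(2) in \<open>auto simp: abs_mult intro!: mult_right_mono\<close>)
    qed measurable
    have htu: "integrable lborel (\<lambda>x. h (x + t) * u x)"
    proof (rule dominated_integral)
      show "integrable lborel (\<lambda>x. C * u x)" using iu by simp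
      have "AE x in lborel. \<bar>h (x + t)\<bar> \<le> C" by (rule AE_shift[OF C]) measurable
      then show "AE x in lborel. norm (h (x + t) * u x) \<le> C * u x"
        by eventually_elim (use u(2) in \<open>auto simp: abs_mult intro!: mult_right_mono\<close>)
    qed measurable
    show "integrable lborel (\<lambda>x. (h (x + t) - h x) * u x)"
      using hu htu by (simp add: left_diff_distrib)
    have hut: "integrable lborel (\<lambda>x. h x * u (x - t))"
      using shift_int[OF htu] by simp
    have "(LINT x|lborel. h x * (u x - u (x - t))) = - (LINT x|lborel. g x * \<Phi> x)"
      using weak[unfolded weak_derivative_def, THEN spec, THEN spec, THEN mp, THEN mp, THEN mp,
          of \<Phi> "\<lambda>x. u x - u (x - t)", OF allI[OF d\<Phi>] continuous_on_diff[OF u(1) us]] \<Phi>0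
      by blast
    moreover have "(LINT x|lborel. h x * (u x - u (x - t))) = (LINT x|lborel. h x * u x) - (LINT x|lborel. h x * u (x - t))"
      using hu hut by (simp add: right_diff_distrib)
    moreover have "(LINT x|lborel. h x * u (x - t)) = (LINT x|lborel. h (x + t) * u x)"
      using shift[of "\<lambda>x. h (x + t) * u x"] by simp
    moreover have "(LINT x|lborel. (h (x + t) - h x) * u x) = (LINT x|lborel. h (x + t) * u x) - (LINT x|lborel. h x * u x)"
      using hu htu by (simp add: left_diff_distrib)
    ultimately have "(LINT x|lborel. (h (x + t) - h x) * u x) = (LINT x|lborel. g x * \<Phi> x)"
      by simp
    moreover have "\<bar>LINT x|lborel. g x * \<Phi> x\<bar> \<le> (LINT x|lborel. M * \<Phi> x)"
      unfolding real_norm_def[symmetric]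
    proof (rule dominated_integral)
      show "AE x in lborel. norm (g x * \<Phi> x) \<le> M * \<Phi> x"
        using M by eventually_elim (use \<Phi>nn in \<open>auto simp: abs_mult intro!: mult_right_mono\<close>)
    qed (use i\<Phi> in auto)
    ultimately show "\<bar>LINT x|lborel. (h (x + t) - h x) * u x\<bar> \<le> M * t * (LINT x|lborel. u x)"
      using mass by simp
  qed
  have Ct: "AE x in lborel. \<bar>h (x + t)\<bar> \<le> C" by (rule AE_shift[OF C]) measurable
  have "AE x in lborel. M * t - (h (x + t) - h x) \<ge> 0"
  proof (rule AE_nonneg_of_test_functions)
    show "AE x in lborel. \<bar>M * t - (h (x + t) - h x)\<bar> \<le> \<bar>M * t\<bar> + 2 * C"
      using C Ct by eventually_elim auto
    fix u :: "real \<Rightarrow> real" and R assume u: "continuous_on UNIV u" "\<And>x. u x \<ge> 0" "\<And>x. \<bar>x\<bar> > R \<Longrightarrow> u x = 0"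
    note T = test[where u=u and R=R, OF u] int1[where u=u and R=R, OF u] int2[where u=u and R=R, OF u]
    have "(LINT x|lborel. (M * t - (h (x + t) - h x)) * u x) = (LINT x|lborel. M * t * u x - (h (x + t) - h x) * u x)"
      by (simp only: left_diff_distrib)
    also have "\<dots> = (LINT x|lborel. M * t * u x) - (LINT x|lborel. (h (x + t) - h x) * u x)"
      by (intro Bochner_Integration.integral_diff integrable_mult_right T)
    also have "\<dots> \<ge> 0" using T(1) by simp
    finally show "(LINT x|lborel. (M * t - (h (x + t) - h x)) * u x) \<ge> 0" by simp
  qed measurable
  moreover have "AE x in lborel. M * t + (h (x + t) - h x) \<ge> 0"
  proof (rule AE_nonneg_of_test_functions)
    show "AE x in lborel. \<bar>M * t + (h (x + t) - h x)\<bar> \<le> \<bar>M * t\<bar> + 2 * C"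
      using C Ct by eventually_elim auto
    fix u :: "real \<Rightarrow> real" and R assume u: "continuous_on UNIV u" "\<And>x. u x \<ge> 0" "\<And>x. \<bar>x\<bar> > R \<Longrightarrow> u x = 0"
    note T = test[where u=u and R=R, OF u] int1[where u=u and R=R, OF u] int2[where u=u and R=R, OF u]
    have "(LINT x|lborel. (M * t + (h (x + t) - h x)) * u x) = (LINT x|lborel. M * t * u x + (h (x + t) - h x) * u x)"
      by (simp only: distrib_right)
    also have "\<dots> = (LINT x|lborel. M * t * u x) + (LINT x|lborel. (h (x + t) - h x) * u x)"
      by (intro Bochner_Integration.integral_add integrable_mult_right T)
    also have "\<dots> \<ge> 0" using T(1) by simp
    finally show "(LINT x|lborel. (M * t + (h (x + t) - h x)) * u x) \<ge> 0" by simp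
  qed measurable
  ultimately show ?thesis by eventually_elim auto
qed

text \<open>The form in which the regularity of q is used. The size bound holds at every point, so
  that integrands can be estimated pointwise. The increment bound holds almost everywhere and only
  for steps up to 1, for which moving the exponential weight from x + \<delta> to x costs a fixed
  factor.\<close>

locale exp_profile =
  fixes \<rho> C L :: real and q :: "real \<Rightarrow> real"
  assumes rho_pos: "\<rho> > 0" and L_nonneg: "L \<ge> 0"
    and q_measurable [measurable]: "q \<in> borel_measurable borel"
    and q_bound: "\<bar>q x\<bar> \<le> C * exp (- (\<rho> * \<bar>x\<bar>))"
    and q_lipschitz: "0 < \<delta> \<Longrightarrow> \<delta> \<le> 1 \<Longrightarrow> AE x in lborel. \<bar>q (x + \<delta>) - q x\<bar> \<le> L * \<delta> * exp (- (\<rho> * \<bar>x\<bar>))"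

lemma abs_exp_minus_one_le: "\<bar>exp y - 1\<bar> \<le> \<bar>y\<bar> * exp \<bar>y\<bar>" for y :: real
proof (cases "y \<ge> 0")
  case True
  have "(1 - y) * exp y \<le> exp (- y) * exp y"
    using exp_ge_add_one_self[of "-y"] by (intro mult_right_mono) auto
  with True show ?thesis by (simp add: exp_minus algebra_simps)
next
  case False
  then have "exp y \<le> 1" by simp
  with False exp_ge_add_one_self[of y] have "\<bar>exp y - 1\<bar> \<le> \<bar>y\<bar>" by linarith
  then have "\<bar>exp y - 1\<bar> \<le> \<bar>y\<bar> * 1" by simp
  also have "\<dots> \<le> \<bar>y\<bar> * exp \<bar>y\<bar>" by (intro mult_left_mono) auto
  finally show ?thesis .
qed

text \<open>Setting q to 0 on the null set where the essential bound fails makes the bound hold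
  everywhere. The increment bound is a discrete product rule for the weight times h: the weak
  derivative controls the increment of h, and |exp y - 1| controls that of the weight.\<close>

lemma W1_infty_imp_exp_profile:
  assumes rho: "\<rho> > 0" and W: "W1_infty (\<lambda>x. exp (\<rho> * \<bar>x\<bar>) * q x)"
  obtains C L p where "exp_profile \<rho> C L p" "AE x in lborel. q x = p x" "q \<in> borel_measurable borel"
proof -
  define h where "h = (\<lambda>x. exp (\<rho> * \<bar>x\<bar>) * q x)"
  have qh: "q = (\<lambda>x. exp (- (\<rho> * \<bar>x\<bar>)) * h x)"
    by (simp add: h_def fun_eq_iff exp_minus)
  from W obtain g C M where h: "h \<in> borel_measurable borel" "AE x in lborel. \<bar>h x\<bar> \<le> C"
    and g: "g \<in> borel_measurable borel" "AE x in lborel. \<bar>g x\<bar> \<le> M" and weak: "weak_derivative h g"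
    unfolding W1_infty_def L_infty_def h_def[symmetric] by auto
  note [measurable] = h(1)
  have [measurable]: "q \<in> borel_measurable borel" unfolding qh by measurable
  define p where "p = (\<lambda>x. if \<bar>h x\<bar> \<le> C then q x else 0)"
  \<comment> \<open>The factor exp \<rho> pays for shifting the weight by at most 1; the second
    summand is the weight's own variation times the bound on h.\<close>
  define L where "L = exp \<rho> * (\<bar>M\<bar> + \<rho> * \<bar>C\<bar>)"
  have "exp_profile \<rho> \<bar>C\<bar> L p"
  proof
    show "\<rho> > 0" by fact
    show "L \<ge> 0" using rho by (simp add: L_def)
    show "p \<in> borel_measurable borel" unfolding p_def by measurable
    show "\<bar>p x\<bar> \<le> \<bar>C\<bar> * exp (- (\<rho> * \<bar>x\<bar>))" for x
      by (auto simp: p_def qh abs_mult)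
    fix \<delta> :: real assume \<delta>: "0 < \<delta>" "\<delta> \<le> 1"
    have hs: "AE x in lborel. \<bar>h (x + \<delta>)\<bar> \<le> C" by (rule AE_shift[OF h(2)]) measurable
    have "AE x in lborel. \<bar>h (x + \<delta>) - h x\<bar> \<le> M * \<delta>"
      by (rule weak_derivative_bound_imp_AE_lipschitz[OF h g weak \<delta>(1)])
    with h(2) hs show "AE x in lborel. \<bar>p (x + \<delta>) - p x\<bar> \<le> L * \<delta> * exp (- (\<rho> * \<bar>x\<bar>))"
    proof eventually_elim
      case (elim x)
      define a where "a = exp (- (\<rho> * \<bar>x + \<delta>\<bar>))"
      define b where "b = exp (- (\<rho> * \<bar>x\<bar>))"
      define y where "y = \<rho> * \<bar>x\<bar> - \<rho> * \<bar>x + \<delta>\<bar>"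
      have "\<bar>y\<bar> = \<rho> * \<bar>\<bar>x\<bar> - \<bar>x + \<delta>\<bar>\<bar>"
        using rho by (simp add: y_def abs_mult flip: right_diff_distrib)
      also have "\<dots> \<le> \<rho> * \<delta>" using rho \<delta> by (intro mult_left_mono) auto
      finally have y: "\<bar>y\<bar> \<le> \<rho> * \<delta>" .
      also have "\<rho> * \<delta> \<le> \<rho>" using rho \<delta> by simp
      finally have y1: "\<bar>y\<bar> \<le> \<rho>" .
      have ab: "a = b * exp y" by (simp add: a_def b_def y_def flip: exp_add)
      have b0: "b > 0" by (simp add: b_def)
      have "\<bar>a - b\<bar> = b * \<bar>exp y - 1\<bar>"
        using b0 by (simp add: ab abs_mult flip: right_diff_distrib)
           (metis abs_mult abs_of_pos mult.right_neutral right_diff_distrib)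
      also have "\<dots> \<le> b * (\<rho> * \<delta> * exp \<rho>)"
        using b0 y y1 rho \<delta>
        by (intro mult_left_mono order_trans[OF abs_exp_minus_one_le] mult_mono) auto
      finally have 1: "\<bar>a - b\<bar> \<le> b * (\<rho> * \<delta> * exp \<rho>)" .
      have 2: "a \<le> b * exp \<rho>" using b0 y1 by (auto simp: ab)
      have p: "p (x + \<delta>) = a * h (x + \<delta>)" "p x = b * h x"
        using elim by (simp_all add: p_def qh a_def b_def)
      have "p (x + \<delta>) - p x = a * (h (x + \<delta>) - h x) + (a - b) * h x"
        unfolding p by (simp add: algebra_simps)
      also have "\<bar>\<dots>\<bar> \<le> a * \<bar>h (x + \<delta>) - h x\<bar> + \<bar>a - b\<bar> * \<bar>h x\<bar>"
        by (rule order_trans[OF abs_triangle_ineq]) (auto simp: abs_mult a_def)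
      also have "\<dots> \<le> (b * exp \<rho>) * (\<bar>M\<bar> * \<delta>) + (b * (\<rho> * \<delta> * exp \<rho>)) * \<bar>C\<bar>"
      proof (intro add_mono mult_mono 1 2)
        show "\<bar>h (x + \<delta>) - h x\<bar> \<le> \<bar>M\<bar> * \<delta>"
          using elim \<delta> by (meson abs_ge_self less_imp_le mult_right_mono order_trans)
      qed (use elim b0 rho \<delta> in auto)
      also have "\<dots> = L * \<delta> * b" by (simp add: L_def algebra_simps)
      finally show ?case by (simp add: b_def)
    qed
  qed
  moreover have "AE x in lborel. q x = p x"
    using h(2) by eventually_elim (simp add: p_def)
  ultimately show ?thesis using that \<open>q \<in> borel_measurable borel\<close> by blast
qed

section \<open>Invariance under changes of q on null sets\<close>

lemma AE_shift_eq:
  fixes p q :: "real \<Rightarrow> real"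
  assumes "AE x in lborel. q x = p x"
    and [measurable]: "p \<in> borel_measurable borel" "q \<in> borel_measurable borel"
  shows "AE x in lborel. q (x + t) = p (x + t)"
  by (rule AE_shift[OF assms(1)]) measurable

lemma autocorr_cong:
  fixes p q :: "real \<Rightarrow> real"
  assumes eq: "AE x in lborel. q x = p x"
    and [measurable]: "p \<in> borel_measurable borel" "q \<in> borel_measurable borel"
  shows "autocorr q = autocorr p"
proof
  fix t
  have "AE x in lborel. q (x + t) * q x = p (x + t) * p x"
    using eq AE_shift_eq[OF assms, of t] by eventually_elim simp
  then show "autocorr q t = autocorr p t"
    unfolding autocorr_def by (intro integral_cong_AE) measurable
qed

lemma
  fixes p q :: "real \<Rightarrow> real"
  assumes eq: "AE x in lborel. q x = p x"
    and [measurable]: "p \<in> borel_measurable borel" "q \<in> borel_measurable borel"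
  shows V_fun_cong: "V_fun q = V_fun p"
    and unique_simple_pole_at_cong: "unique_simple_pole_at \<rho> q = unique_simple_pole_at \<rho> p"
    and theta_cong: "theta \<rho> q = theta \<rho> p"
    and sigma_fun_cong: "sigma_fun \<rho> q = sigma_fun \<rho> p"
proof -
  show V: "V_fun q = V_fun p"
    by (simp add: V_fun_def K_fun_def fun_eq_iff autocorr_cong[OF assms])
  show u: "unique_simple_pole_at \<rho> q = unique_simple_pole_at \<rho> p"
    by (simp add: unique_simple_pole_at_def fun_eq_iff V)
  show th: "theta \<rho> q = theta \<rho> p"
    by (simp add: theta_def fun_eq_iff u)
  show "sigma_fun \<rho> q = sigma_fun \<rho> p"
  proof (intro ext)
    fix \<omega> l
    show "sigma_fun \<rho> q \<omega> l = sigma_fun \<rho> p \<omega> l"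
      unfolding sigma_fun_def th set_lebesgue_integral_def
    proof (intro integral_cong_AE)
      show "AE t in lborel.
         indicator {0..} t *\<^sub>R (exp ((of_real (theta \<rho> p \<omega>) + \<i> * of_real \<omega>) * of_real t) * of_real (q (t + l))) =
         indicator {0..} t *\<^sub>R (exp ((of_real (theta \<rho> p \<omega>) + \<i> * of_real \<omega>) * complex_of_real t) * of_real (p (t + l)))"
        using AE_shift_eq[OF assms, of l] by eventually_elim simp
    qed measurable
  qed
qed

text \<open>For fixed x, the map s to x - s preserves null sets, and q enters only under the time
  integral. Hence the two representatives agree at every (x, t), not just almost everywhere.\<close>

lemma duhamel_cong:
  fixes p q a :: "real \<Rightarrow> real"
  assumes eq: "AE x in lborel. q x = p x"
    and [measurable]: "p \<in> borel_measurable borel" "q \<in> borel_measurable borel" "a \<in> borel_measurable borel"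
  shows "duhamel \<omega> q \<psi>\<^sub>0 a = duhamel \<omega> p \<psi>\<^sub>0 a"
proof (intro ext)
  fix x t
  have *: "AE s in lborel. q (x + (-1) * s) = p (x + (-1) * s)"
    by (rule AE_borel_affine[of "-1" "\<lambda>s. q s = p s" x]) (use eq in auto)
  have "(LBINT s=0..t. exp (\<i> * of_real (\<omega> * (t - s))) * of_real (a s * q (x - s))) =
        (LBINT s=0..t. exp (\<i> * of_real (\<omega> * (t - s))) * complex_of_real (a s * p (x - s)))"
  proof (rule interval_integral_cong_AE)
    show "AE s\<in>einterval (min 0 (ereal t)) (max 0 (ereal t)) in lborel.
       exp (\<i> * of_real (\<omega> * (t - s))) * complex_of_real (a s * q (x - s)) =
       exp (\<i> * of_real (\<omega> * (t - s))) * complex_of_real (a s * p (x - s))"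
      using * by eventually_elim simp
  qed measurable
  then show "duhamel \<omega> q \<psi>\<^sub>0 a x t = duhamel \<omega> p \<psi>\<^sub>0 a x t"
    by (simp add: duhamel_def)
qed

text \<open>The evolution equation is required only for almost every x at each t, and everywhere
  else q stands under an integral. So the notion of solution does not see the change of
  representative.\<close>

lemma solution_cong:
  fixes p q :: "real \<Rightarrow> real"
  assumes eq: "AE x in lborel. q x = p x"
    and [measurable]: "p \<in> borel_measurable borel" "q \<in> borel_measurable borel"
    and sol: "solution \<omega> q \<psi>\<^sub>0 a\<^sub>0 \<psi> a"
  shows "solution \<omega> p \<psi>\<^sub>0 a\<^sub>0 \<psi> a"
proof -
  from sol obtain \<psi>' a' where *: "L2_C1_curve \<psi> \<psi>'"
    "\<And>t. (a has_real_derivative a' t) (at t)" "continuous_on UNIV a'"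
    "\<And>t. AE x in lborel. \<psi>' x t = \<i> * of_real \<omega> * \<psi> x t + of_real (\<omega> * a t * q (x - t))"
    "\<And>t. a' t = - (1 / \<omega>) * (LINT x|lborel. Re (\<psi> x t) * q (x - t))"
    "AE x in lborel. \<psi> x 0 = \<psi>\<^sub>0 x" "a 0 = a\<^sub>0" "\<And>x t. \<psi> x t = duhamel \<omega> q \<psi>\<^sub>0 a x t"
    unfolding solution_def C1_solution_def by blast
  have [measurable]: "a \<in> borel_measurable borel"
    using *(2) by (intro borel_measurable_continuous_onI)
      (auto simp: continuous_on_eq_continuous_at intro: DERIV_isCont)
  have shift: "AE x in lborel. q (x - t) = p (x - t)" for t
    using AE_shift_eq[OF assms(1-3), of "-t"] by simp
  have "AE x in lborel. \<psi>' x t = \<i> * of_real \<omega> * \<psi> x t + of_real (\<omega> * a t * p (x - t))" for t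
    using *(4)[of t] shift[of t] by eventually_elim simp
  moreover have "a' t = - (1 / \<omega>) * (LINT x|lborel. Re (\<psi> x t) * p (x - t))" for t
  proof -
    have [measurable]: "(\<lambda>x. \<psi> x t) \<in> borel_measurable borel"
      using *(1) by (auto simp: L2_C1_curve_def L2_fun_def)
    have "(LINT x|lborel. Re (\<psi> x t) * q (x - t)) = (LINT x|lborel. Re (\<psi> x t) * p (x - t))"
    proof (intro integral_cong_AE)
      show "AE x in lborel. Re (\<psi> x t) * q (x - t) = Re (\<psi> x t) * p (x - t)"
        using shift[of t] by eventually_elim simp
    qed measurable
    then show ?thesis using *(5) by simp
  qed
  moreover have "\<psi> x t = duhamel \<omega> p \<psi>\<^sub>0 a x t" for x t
    using *(8) duhamel_cong[OF assms(1-3), of a \<omega> \<psi>\<^sub>0] by simp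
  ultimately show ?thesis
    unfolding solution_def C1_solution_def using *(1,2,3,6,7) by blast
qed

section \<open>The autocorrelation and its transform\<close>

context exp_profile
begin

text \<open>Any rate strictly between \<open>\<rho> / 2\<close> and \<open>\<rho>\<close> would do for \<open>\<nu>\<close>; transforms are estimated
  on the half-plane \<open>Re z \<ge> - 5 / 8 * \<rho>\<close>, which leaves room on both sides.\<close>

definition \<nu> :: real where "\<nu> = 3 / 4 * \<rho>"

text \<open>The rate \<rho>/4 is \<rho> - \<nu>, the share of the weight kept for integrability in
  x.\<close>

definition J :: real where "J = (LINT x|lborel. exp (- (\<rho> / 4 * \<bar>x\<bar>)))"

lemma J_nonneg: "J \<ge> 0"
  unfolding J_def by (rule Bochner_Integration.integral_nonneg) auto

lemma C_nonneg: "C \<ge> 0"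
  using q_bound[of 0] by simp

text \<open>By |t| \<le> |x| + |x + t|, three quarters of both weights become decay in t, and the
  remaining quarter of the weight in x makes the integral converge.\<close>

lemma correlation_bound:
  fixes w :: "real \<Rightarrow> 'b::{banach, second_countable_topology}"
  assumes w: "w \<in> borel_measurable borel"
    and A: "A \<ge> 0" "AE x in lborel. norm (w x) \<le> A * exp (- (\<rho> * \<bar>x\<bar>)) * exp (- (\<rho> * \<bar>x + t\<bar>))"
  shows "integrable lborel w" "norm (integral\<^sup>L lborel w) \<le> A * J * exp (- (\<nu> * \<bar>t\<bar>))"
proof -
  have int: "integrable lborel (\<lambda>x. A * exp (- (\<nu> * \<bar>t\<bar>)) * exp (- (\<rho> / 4 * \<bar>x\<bar>)))"
    using rho_pos by (intro integrable_mult_right integrable_exp_neg_abs) auto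
  have le: "AE x in lborel. norm (w x) \<le> A * exp (- (\<nu> * \<bar>t\<bar>)) * exp (- (\<rho> / 4 * \<bar>x\<bar>))"
    using A(2)
  proof eventually_elim
    case (elim x)
    have "3 / 4 * \<rho> * \<bar>t\<bar> \<le> 3 / 4 * \<rho> * (\<bar>x + t\<bar> + \<bar>x\<bar>)"
      using rho_pos by (intro mult_left_mono) auto
    moreover have "1 / 4 * \<rho> * \<bar>x + t\<bar> \<ge> 0" using rho_pos by simp
    ultimately have "\<nu> * \<bar>t\<bar> + \<rho> / 4 * \<bar>x\<bar> \<le> \<rho> * \<bar>x\<bar> + \<rho> * \<bar>x + t\<bar>"
      by (simp add: \<nu>_def distrib_left)
    then have "A * exp (- (\<rho> * \<bar>x\<bar>) + - (\<rho> * \<bar>x + t\<bar>)) \<le> A * exp (- (\<nu> * \<bar>t\<bar>) + - (\<rho> / 4 * \<bar>x\<bar>))"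
      by (intro mult_left_mono A) simp
    with elim show ?case by (simp add: mult.assoc flip: exp_add)
  qed
  note * = dominated_integral[OF _ int le]
  show "integrable lborel w" by (rule *(1)) (use w in simp)
  have "norm (integral\<^sup>L lborel w) \<le> (LINT x|lborel. A * exp (- (\<nu> * \<bar>t\<bar>)) * exp (- (\<rho> / 4 * \<bar>x\<bar>)))"
    by (rule *(2)) (use w in simp)
  then show "norm (integral\<^sup>L lborel w) \<le> A * J * exp (- (\<nu> * \<bar>t\<bar>))"
    by (simp add: J_def mult_ac)
qed

definition g :: "real \<Rightarrow> real" where "g = autocorr q"

definition G :: real where "G = C * C * J"
definition G' :: real where "G' = C * L * J"

lemma G_nonneg: "G \<ge> 0" and G'_nonneg: "G' \<ge> 0"
  using C_nonneg L_nonneg J_nonneg by (auto simp: G_def G'_def)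

lemma g_measurable [measurable]: "g \<in> borel_measurable borel"
  unfolding g_def autocorr_def[abs_def] by measurable

lemma
  assumes "t \<ge> 0"
  shows g_integrable: "integrable lborel (\<lambda>x. q (x + t) * q x)"
    and g_bound: "\<bar>g t\<bar> \<le> G * exp (- (\<nu> * t))"
proof -
  have "AE x in lborel. norm (q (x + t) * q x) \<le> C * C * exp (- (\<rho> * \<bar>x\<bar>)) * exp (- (\<rho> * \<bar>x + t\<bar>))"
  proof (rule AE_I2)
    fix x
    have "\<bar>q (x + t)\<bar> * \<bar>q x\<bar> \<le> (C * exp (- (\<rho> * \<bar>x + t\<bar>))) * (C * exp (- (\<rho> * \<bar>x\<bar>)))"
      by (intro mult_mono q_bound) (auto simp: C_nonneg)
    then show "norm (q (x + t) * q x) \<le> C * C * exp (- (\<rho> * \<bar>x\<bar>)) * exp (- (\<rho> * \<bar>x + t\<bar>))"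
      by (simp add: abs_mult mult_ac)
  qed
  note * = correlation_bound[OF _ _ this]
  show "integrable lborel (\<lambda>x. q (x + t) * q x)" by (rule *(1)) (auto simp: C_nonneg)
  have "norm (LINT x|lborel. q (x + t) * q x) \<le> C * C * J * exp (- (\<nu> * \<bar>t\<bar>))"
    by (rule *(2)) (auto simp: C_nonneg)
  then show "\<bar>g t\<bar> \<le> G * exp (- (\<nu> * t))"
    using assms by (simp add: g_def autocorr_def G_def)
qed

lemma g_lipschitz:
  assumes "t \<ge> 0" "0 < \<delta>" "\<delta> \<le> 1"
  shows "\<bar>g (t + \<delta>) - g t\<bar> \<le> G' * \<delta> * exp (- (\<nu> * t))"
proof -
  have "AE x in lborel. \<bar>q (x + t + \<delta>) - q (x + t)\<bar> \<le> L * \<delta> * exp (- (\<rho> * \<bar>x + t\<bar>))"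
    by (rule AE_shift[OF q_lipschitz[OF assms(2,3)]]) measurable
  then have AE: "AE x in lborel. norm ((q (x + t + \<delta>) - q (x + t)) * q x)
      \<le> C * L * \<delta> * exp (- (\<rho> * \<bar>x\<bar>)) * exp (- (\<rho> * \<bar>x + t\<bar>))"
  proof eventually_elim
    case (elim x)
    have "\<bar>q (x + t + \<delta>) - q (x + t)\<bar> * \<bar>q x\<bar> \<le> (L * \<delta> * exp (- (\<rho> * \<bar>x + t\<bar>))) * (C * exp (- (\<rho> * \<bar>x\<bar>)))"
      using L_nonneg assms by (intro mult_mono q_bound elim) auto
    then show ?case by (simp add: abs_mult mult_ac)
  qed
  have "g (t + \<delta>) - g t = (LINT x|lborel. (q (x + t + \<delta>) - q (x + t)) * q x)"
    using g_integrable[of "t + \<delta>"] g_integrable[of t] assms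
    by (simp add: g_def autocorr_def left_diff_distrib add.assoc)
  moreover have "norm (LINT x|lborel. (q (x + t + \<delta>) - q (x + t)) * q x) \<le> C * L * \<delta> * J * exp (- (\<nu> * \<bar>t\<bar>))"
    by (rule correlation_bound(2)[OF _ _ AE]) (use C_nonneg L_nonneg assms in auto)
  ultimately show ?thesis using assms by (simp add: G'_def mult_ac)
qed

text \<open>A truncated Laplace transform that serves two purposes: \<open>T\<close> = 0 at z
  \<plusminus> i \<omega> gives \<open>K_fun\<close>, and general \<open>T\<close> at - \<theta> - i
  \<omega> gives the tail integral \<kappa> as its real part.\<close>

definition B :: "real \<Rightarrow> complex \<Rightarrow> complex" where
  "B T z = (LINT t:{T..}|lborel. exp (- z * of_real t) * of_real (g t))"

lemma B_integrable:
  assumes "T \<ge> 0" "\<nu> + Re z > 0"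
  shows "set_integrable lborel {T..} (\<lambda>t. exp (- z * of_real t) * complex_of_real (g t))"
  by (rule laplace_tail(1)[OF _ g_bound assms(2)]) (use assms in auto)

lemma B_bound:
  assumes "T \<ge> 0" "\<nu> + Re z > 0"
  shows "cmod (B T z) \<le> G * exp (- ((\<nu> + Re z) * T)) / (\<nu> + Re z)"
  unfolding B_def by (rule laplace_tail(2)[OF _ g_bound assms(2)]) (use assms in auto)

text \<open>Integration by parts without differentiability of \<open>g\<close>: comparing the integral with its
  translate by \<open>h\<close> produces the factor \<open>(1 - exp (- z h)) / h \<longlonglongrightarrow> z\<close>.\<close>

lemma B_difference_bound:
  assumes T: "T \<ge> 0" and z: "\<nu> + Re z > 0" and h: "0 < h" "h \<le> 1"
  shows "cmod ((1 - exp (- z * of_real h)) / of_real h * B T z)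
    \<le> G * exp (- ((\<nu> + Re z) * T)) + exp (- (Re z * h)) * (G' * exp (- ((\<nu> + Re z) * T)) / (\<nu> + Re z))"
proof -
  let ?E = "\<lambda>t. exp (- z * of_real t) * complex_of_real (g t)"
  let ?x = "\<nu> + Re z"
  have i: "set_integrable lborel {T..} ?E" by (rule B_integrable[OF T z])
  have i1: "set_integrable lborel {T..<T+h} ?E" and i2: "set_integrable lborel {T+h..} ?E"
    by (rule set_integrable_subset[OF i]; use h in auto)+
  have ind: "indicator {T+h..} (h + 1 * t) *\<^sub>R ?E (h + 1 * t) = indicator {T..} t *\<^sub>R ?E (t + h)" for t
    by (simp add: indicator_def add.commute)
  have disj: "{T..<T+h} \<inter> {T+h..} = {}" by auto
  have "{T..} = {T..<T+h} \<union> {T+h..}" using h by auto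
  then have "B T z = (LINT t:{T..<T+h}|lborel. ?E t) + (LINT t:{T+h..}|lborel. ?E t)"
    unfolding B_def using set_integral_Un[OF disj i1 i2] by simp
  also have "(LINT t:{T+h..}|lborel. ?E t) = (LINT t:{T..}|lborel. ?E (t + h))"
    unfolding set_lebesgue_integral_def
    using lborel_integral_real_affine[of 1 "\<lambda>t. indicator {T+h..} t *\<^sub>R ?E t" h]
    unfolding ind by simp
  finally have 1: "B T z = (LINT t:{T..<T+h}|lborel. ?E t) + (LINT t:{T..}|lborel. ?E (t + h))" .
  have ish: "set_integrable lborel {T..} (\<lambda>t. ?E (t + h))"
    using lborel_integrable_real_affine[OF i2[unfolded set_integrable_def], of 1 h]
    unfolding set_integrable_def ind by simp
  have "(LINT t:{T..}|lborel. ?E (t + h) - exp (- z * of_real h) * ?E t) =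
      (LINT t:{T..}|lborel. ?E (t + h)) - exp (- z * of_real h) * B T z"
    unfolding B_def set_integral_mult_right[symmetric]
    by (rule set_integral_diff(2)[OF ish set_integrable_mult_right]) (rule i)
  then have "B T z - exp (- z * of_real h) * B T z = (LINT t:{T..<T+h}|lborel. ?E t) +
      (LINT t:{T..}|lborel. ?E (t + h) - exp (- z * of_real h) * ?E t)"
    using 1 by (simp only:) (simp only: algebra_simps)
  also have "(LINT t:{T..}|lborel. ?E (t + h) - exp (- z * of_real h) * ?E t) =
      (LINT t:{T..}|lborel. exp (- z * of_real h) * (exp (- z * of_real t) * of_real (g (t + h) - g t)))"
  proof (intro set_lebesgue_integral_cong allI impI)
    fix t
    have e: "exp (- z * of_real (t + h)) = exp (- z * of_real h) * exp (- z * of_real t)"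
      by (simp add: algebra_simps flip: exp_add)
    show "?E (t + h) - exp (- z * of_real h) * ?E t =
        exp (- z * of_real h) * (exp (- z * of_real t) * of_real (g (t + h) - g t))"
      unfolding e of_real_diff by (simp only: algebra_simps)
  qed auto
  also have "\<dots> = exp (- z * of_real h) * (LINT t:{T..}|lborel. exp (- z * of_real t) * of_real (g (t + h) - g t))"
    by (rule set_integral_mult_right)
  finally have 2: "(1 - exp (- z * of_real h)) * B T z = (LINT t:{T..<T+h}|lborel. ?E t) +
     exp (- z * of_real h) * (LINT t:{T..}|lborel. exp (- z * of_real t) * of_real (g (t + h) - g t))"
    by (simp only: left_diff_distrib mult_1_left)
  \<comment> \<open>Both pieces are of order h, this one by the length of the interval and the next
    by \<open>g_lipschitz\<close>, so the division by h leaves a bounded quantity.\<close>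
  have 3: "cmod (LINT t:{T..<T+h}|lborel. ?E t) \<le> h * (G * exp (- (?x * T)))"
  proof -
    have "cmod (LINT t:{T..<T+h}|lborel. ?E t) \<le> (LINT t:{T..<T+h}|lborel. G * exp (- (?x * T)))"
    proof (rule dominated_set_integral(2))
      fix t assume t: "t \<in> {T..<T + h}"
      have "cmod (?E t) \<le> G * exp (- (?x * t))"
        by (rule laplace_integrand_bound) (use t T g_bound in auto)
      also have "\<dots> \<le> G * exp (- (?x * T))"
        using t z G_nonneg by (intro mult_left_mono) auto
      finally show "cmod (?E t) \<le> G * exp (- (?x * T))" .
    next
      have "integrable lborel (indicator {T..<T+h} :: real \<Rightarrow> real)"
        by (rule integrable_real_indicator) (use h in auto)
      then show "set_integrable lborel {T..<T+h} (\<lambda>t. G * exp (- (?x * T)))"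
        by (simp add: set_integrable_def)
    qed auto
    then show ?thesis using h by (simp add: set_lebesgue_integral_def mult_ac)
  qed
  have 4: "cmod (LINT t:{T..}|lborel. exp (- z * of_real t) * of_real (g (t + h) - g t)) \<le>
      (G' * h) * exp (- (?x * T)) / ?x"
    by (rule laplace_tail(2)[OF _ _ z]) (use T h g_lipschitz in auto)
  have 5: "cmod (exp (- z * of_real h) * (LINT t:{T..}|lborel. exp (- z * of_real t) * of_real (g (t + h) - g t)))
      \<le> exp (- (Re z * h)) * ((G' * h) * exp (- (?x * T)) / ?x)"
    unfolding norm_mult by (rule mult_mono[OF _ 4]) auto
  have "cmod ((1 - exp (- z * of_real h)) / of_real h * B T z) = cmod ((1 - exp (- z * of_real h)) * B T z) / h"
    using h by (simp add: norm_mult norm_divide)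
  also have "\<dots> \<le> (h * (G * exp (- (?x * T))) + exp (- (Re z * h)) * ((G' * h) * exp (- (?x * T)) / ?x)) / h"
    unfolding 2 using h
    by (intro divide_right_mono order_trans[OF norm_triangle_ineq] add_mono 3 5) auto
  also have "\<dots> = G * exp (- (?x * T)) + exp (- (Re z * h)) * (G' * exp (- (?x * T)) / ?x)"
    using h by (simp add: add_divide_distrib)
  finally show ?thesis .
qed

text \<open>Letting h tend to 0 in \<open>B_difference_bound\<close> turns the difference factor
  into z. The resulting 1/|z| decay is the source of every factor 1/\<omega>, since the transform is
  evaluated at points whose modulus is of order \<omega>.\<close>

lemma B_bound_inverse:
  assumes T: "T \<ge> 0" and z: "\<nu> + Re z > 0"
  shows "cmod z * cmod (B T z) \<le> (G + G' / (\<nu> + Re z)) * exp (- ((\<nu> + Re z) * T))"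
proof -
  let ?x = "\<nu> + Re z"
  have *: "((\<lambda>h. (exp (- z * of_real h) - 1) / of_real h) \<longlongrightarrow> - z) (at_right (0::real))"
  proof -
    have "((\<lambda>w. exp (- z * w)) has_field_derivative (- z)) (at 0)"
      by (auto intro!: derivative_eq_intros)
    then have "((\<lambda>w. (exp (- z * w) - 1) / w) \<longlongrightarrow> - z) (at 0)"
      by (simp add: DERIV_def)
    moreover have "filterlim complex_of_real (at 0) (at_right 0)"
    proof (rule filterlim_atI)
      show "(complex_of_real \<longlongrightarrow> 0) (at_right 0)"
        by (rule tendsto_eq_intros refl)+ simp
      show "\<forall>\<^sub>F x in at_right 0. complex_of_real x \<noteq> 0"
        using eventually_at_right_less[of 0] by eventually_elim simp
    qed
    ultimately show ?thesis by (rule filterlim_compose)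
  qed
  have lim: "((\<lambda>h. cmod ((1 - exp (- z * of_real h)) / of_real h * B T z)) \<longlongrightarrow> cmod (- (- z) * B T z)) (at_right (0::real))"
  proof -
    show ?thesis
      using tendsto_norm[OF tendsto_mult[OF tendsto_minus[OF *] tendsto_const[of "B T z"]]]
      by (simp add: minus_divide_left)
  qed
  have lim2: "((\<lambda>h. G * exp (- (?x * T)) + exp (- (Re z * h)) * (G' * exp (- (?x * T)) / ?x)) \<longlongrightarrow>
      G * exp (- (?x * T)) + exp (- (Re z * 0)) * (G' * exp (- (?x * T)) / ?x)) (at_right 0)"
    by (intro tendsto_intros)
  have "cmod (- (- z) * B T z) \<le> G * exp (- (?x * T)) + exp (- (Re z * 0)) * (G' * exp (- (?x * T)) / ?x)"
  proof (rule tendsto_le[OF _ lim2 lim])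
    show "\<forall>\<^sub>F h in at_right 0. cmod ((1 - exp (- z * of_real h)) / of_real h * B T z)
       \<le> G * exp (- (?x * T)) + exp (- (Re z * h)) * (G' * exp (- (?x * T)) / ?x)"
      unfolding eventually_at_right_field
      by (rule exI[of _ 1]) (use B_difference_bound[OF T z] in auto)
  qed auto
  then show ?thesis by (simp add: norm_mult algebra_simps)
qed

section \<open>Size and holomorphy of K\<close>

lemma K_fun_eq_B:
  assumes "\<nu> + Re z > 0"
  shows "K_fun q \<omega> z = (B 0 (z - \<i> * of_real \<omega>) + B 0 (z + \<i> * of_real \<omega>)) / 2"
proof -
  have i: "set_integrable lborel {0..} (\<lambda>t. exp (- (z - \<i> * of_real \<omega>) * of_real t) * complex_of_real (g t))"
    "set_integrable lborel {0..} (\<lambda>t. exp (- (z + \<i> * of_real \<omega>) * of_real t) * complex_of_real (g t))"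
    by (rule B_integrable; use assms in simp)+
  have "K_fun q \<omega> z = (LINT t:{0..}|lborel. (1/2) * (exp (- (z - \<i> * of_real \<omega>) * of_real t) * complex_of_real (g t)
     + exp (- (z + \<i> * of_real \<omega>) * of_real t) * complex_of_real (g t)))"
    unfolding K_fun_def
  proof (intro set_lebesgue_integral_cong allI impI)
    fix t
    have c: "complex_of_real (cos (\<omega> * t)) = (exp (\<i> * of_real (\<omega> * t)) + exp (- \<i> * of_real (\<omega> * t))) / 2"
      using cos_exp_eq[of "complex_of_real (\<omega> * t)"] unfolding cos_of_real by simp
    show "exp (- z * of_real t) * of_real (cos (\<omega> * t) * autocorr q t) =
      (1/2) * (exp (- (z - \<i> * of_real \<omega>) * of_real t) * complex_of_real (g t)
     + exp (- (z + \<i> * of_real \<omega>) * of_real t) * complex_of_real (g t))"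
    proof -
      have e: "exp (- (z - \<i> * of_real \<omega>) * of_real t) = exp (- z * of_real t) * exp (\<i> * of_real (\<omega> * t))"
        "exp (- (z + \<i> * of_real \<omega>) * of_real t) = exp (- z * of_real t) * exp (- \<i> * of_real (\<omega> * t))"
        by (simp_all add: algebra_simps flip: exp_add)
      show ?thesis
        unfolding of_real_mult[of "cos _"] c g_def[symmetric] e by (simp add: ring_distribs)
    qed
  qed auto
  also have "\<dots> = (B 0 (z - \<i> * of_real \<omega>) + B 0 (z + \<i> * of_real \<omega>)) / 2"
    using i by (simp add: B_def set_integral_add(2)[OF i])
  finally show ?thesis .
qed

text \<open>On the half-plane Re z \<ge> - 5/8 \<rho> the denominator \<nu> + Re z is at least
  \<rho>/8, whence the factor 8/\<rho>.\<close>

definition M :: real where "M = G + 8 * G' / \<rho>"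

lemma M_nonneg: "M \<ge> 0"
  using G_nonneg G'_nonneg rho_pos by (simp add: M_def)

lemma B_bound_M:
  assumes T: "T \<ge> 0" and z: "Re z \<ge> - (5 / 8 * \<rho>)"
  shows "cmod z * cmod (B T z) \<le> M * exp (- ((\<nu> + Re z) * T))"
proof -
  have x: "\<nu> + Re z \<ge> \<rho> / 8" using z by (simp add: \<nu>_def)
  then have "G' / (\<nu> + Re z) \<le> G' / (\<rho> / 8)"
    using rho_pos G'_nonneg by (intro divide_left_mono) auto
  then have "(G + G' / (\<nu> + Re z)) * exp (- ((\<nu> + Re z) * T)) \<le> M * exp (- ((\<nu> + Re z) * T))"
    by (intro mult_right_mono) (auto simp: M_def mult.commute)
  with B_bound_inverse[OF T, of z] x rho_pos show ?thesis by linarith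
qed

text \<open>A crude bound without decay in \<omega>, but valid on the whole half-plane, also near
  \<plusminus> i \<omega> where the oscillation is in resonance. It serves to exclude zeros of z + K
  z far from the origin.\<close>

lemma K_fun_bound:
  assumes z: "Re z \<ge> - (5 / 8 * \<rho>)"
  shows "cmod (K_fun q \<omega> z) \<le> 8 * G / \<rho>"
proof -
  have x: "\<nu> + Re z \<ge> \<rho> / 8" using z by (simp add: \<nu>_def)
  have "cmod (B 0 w) \<le> 8 * G / \<rho>" if "Re w = Re z" for w
  proof -
    have "cmod (B 0 w) \<le> G / (\<nu> + Re z)"
      using B_bound[of 0 w] that x rho_pos by simp
    also have "\<dots> \<le> G / (\<rho> / 8)" using x rho_pos G_nonneg by (intro divide_left_mono) auto
    finally show ?thesis by (simp add: mult.commute)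
  qed
  from this[of "z - \<i> * of_real \<omega>"] this[of "z + \<i> * of_real \<omega>"]
    norm_triangle_ineq[of "B 0 (z - \<i> * of_real \<omega>)" "B 0 (z + \<i> * of_real \<omega>)"]
  show ?thesis
    using x rho_pos by (subst K_fun_eq_B) (auto simp: norm_divide)
qed

text \<open>For |z| \<le> \<omega>/2 both arguments z \<plusminus> i \<omega> have modulus at least
  \<omega>/2, so each half of \<open>K_fun\<close> gains the factor 1/\<omega>.\<close>

lemma K_fun_bound_near_0:
  assumes z: "Re z \<ge> - (5 / 8 * \<rho>)" "cmod z \<le> \<omega> / 2" and \<omega>: "\<omega> > 0"
  shows "cmod (K_fun q \<omega> z) \<le> 2 * M / \<omega>"
proof -
  have x: "\<nu> + Re z \<ge> \<rho> / 8" using z by (simp add: \<nu>_def)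
  have "cmod (B 0 w) \<le> 2 * M / \<omega>" if "Re w = Re z" "cmod w \<ge> \<omega> / 2" for w
  proof -
    have "\<omega> / 2 * cmod (B 0 w) \<le> cmod w * cmod (B 0 w)"
      using that by (intro mult_right_mono) auto
    also have "\<dots> \<le> M" using B_bound_M[of 0 w] that z by simp
    finally show ?thesis using \<omega> by (simp add: field_simps)
  qed
  moreover have "cmod (z - \<i> * of_real \<omega>) \<ge> \<omega> / 2" "cmod (z + \<i> * of_real \<omega>) \<ge> \<omega> / 2"
    using norm_triangle_ineq3[of z "\<i> * of_real \<omega>"] norm_triangle_ineq3[of z "- \<i> * of_real \<omega>"] z \<omega>
    by (auto simp: norm_mult)
  ultimately have "cmod (B 0 (z - \<i> * of_real \<omega>)) \<le> 2 * M / \<omega>" "cmod (B 0 (z + \<i> * of_real \<omega>)) \<le> 2 * M / \<omega>"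
    by auto
  with norm_triangle_ineq[of "B 0 (z - \<i> * of_real \<omega>)" "B 0 (z + \<i> * of_real \<omega>)"]
  show ?thesis
    using x rho_pos by (subst K_fun_eq_B) (auto simp: norm_divide)
qed

lemma K_fun_holomorphic: "K_fun q \<omega> holomorphic_on {z. Re z > - \<nu>}"
proof -
  have "K_fun q \<omega> field_differentiable at z" if "Re z > - \<nu>" for z
    unfolding field_differentiable_def K_fun_def[abs_def]
  proof (intro exI, rule laplace_has_derivative)
    show "(\<lambda>t. cos (\<omega> * t) * autocorr q t) \<in> borel_measurable borel"
      unfolding g_def[symmetric] by measurable
    fix t :: real assume "t \<ge> 0"
    have "\<bar>cos (\<omega> * t)\<bar> * \<bar>g t\<bar> \<le> 1 * (G * exp (- (\<nu> * t)))"
      by (intro mult_mono g_bound \<open>t \<ge> 0\<close>) auto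
    then show "\<bar>cos (\<omega> * t) * autocorr q t\<bar> \<le> G * exp (- (\<nu> * t))"
      by (simp add: abs_mult g_def)
  qed (use that in auto)
  then show ?thesis
    by (auto simp: holomorphic_on_def intro: field_differentiable_at_within)
qed

text \<open>Realness on the real axis lets a zero be found by a sign change, and it identifies the
  value at - \<theta> with a real integral of \<open>k\<close>.\<close>

lemma K_fun_of_real:
  "K_fun q \<omega> (of_real x) = of_real (LINT t:{0..}|lborel. exp (- x * t) * (cos (\<omega> * t) * g t))"
proof -
  have "K_fun q \<omega> (of_real x) = (LINT t:{0..}|lborel. of_real (exp (- x * t) * (cos (\<omega> * t) * g t)))"
    unfolding K_fun_def g_def by (simp flip: exp_of_real)
  also have "\<dots> = of_real (LINT t:{0..}|lborel. exp (- x * t) * (cos (\<omega> * t) * g t))"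
    by (rule set_integral_complex_of_real)
  finally show ?thesis .
qed

text \<open>The second condition makes K at most \<rho>/16 near 0 and its derivative at most 1/2;
  the third puts the disc of radius 5/8 \<rho> inside |z| \<le> \<omega>/2; the last excludes zeros
  of z + K z with |z| > \<omega>/2.\<close>

definition large :: "real \<Rightarrow> bool" where
  "large \<omega> \<longleftrightarrow> \<omega> > 0 \<and> 32 * M / \<rho> \<le> \<omega> \<and> 2 * \<rho> \<le> \<omega> \<and> 16 * G / \<rho> < \<omega>"

lemma eventually_large: "eventually large at_top"
proof -
  have "\<forall>\<^sub>F \<omega> in at_top. \<omega> > 0 \<and> 32 * M / \<rho> \<le> \<omega> \<and> 2 * \<rho> \<le> \<omega> \<and> 16 * G / \<rho> < \<omega>"
    by (intro eventually_conj eventually_gt_at_top eventually_ge_at_top)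
  then show ?thesis by (simp add: large_def[abs_def])
qed

lemma largeD:
  assumes "large \<omega>"
  shows "\<omega> > 0" "2 * M / \<omega> \<le> \<rho> / 16" "16 * (M / \<omega>) / \<rho> \<le> 1 / 2" "2 * \<rho> \<le> \<omega>" "8 * G / \<rho> < \<omega> / 2"
  using assms rho_pos by (auto simp: large_def field_simps)

text \<open>Cauchy's inequality on discs of radius \<rho>/8, which stay in the half-plane Re z \<ge>
  - 5/8 \<rho>, bounds the derivative by (2 M / \<omega>) / (\<rho>/8) \<le> 1/2. The difference
  bound gives uniqueness of the zero, the derivative bound its simplicity.\<close>

lemma K_fun_contraction:
  assumes "large \<omega>" "cmod z \<le> \<rho> / 2" "cmod w \<le> \<rho> / 2"
  shows "cmod (K_fun q \<omega> z - K_fun q \<omega> w) \<le> 1 / 2 * cmod (z - w)"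
    and "cmod (deriv (K_fun q \<omega>) z) \<le> 1 / 2"
proof -
  note l = largeD[OF assms(1)]
  have op: "open {z. Re z > - \<nu>}" by (simp add: open_halfspace_Re_gt)
  have bd: "cmod (deriv (K_fun q \<omega>) z) \<le> 1 / 2" if "cmod z \<le> \<rho> / 2" for z
  proof -
    have sub: "Re x \<ge> - (5 / 8 * \<rho>) \<and> cmod x \<le> \<omega> / 2 \<and> Re x > - \<nu>" if x: "x \<in> cball z (\<rho> / 8)" for x :: complex
    proof -
      have "cmod x \<le> cmod z + cmod (z - x)" by (metis norm_triangle_sub add.commute norm_minus_commute)
      with x \<open>cmod z \<le> \<rho> / 2\<close> have "cmod x \<le> 5 / 8 * \<rho>" by (simp add: dist_norm)
      with abs_Re_le_cmod[of x] l(4) rho_pos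
      have "- (5 / 8 * \<rho>) \<le> Re x" "cmod x \<le> \<omega> / 2" by linarith+
      moreover from this rho_pos have "- \<nu> < Re x" unfolding \<nu>_def by linarith
      ultimately show ?thesis by blast
    qed
    have hol: "K_fun q \<omega> holomorphic_on cball z (\<rho> / 8)"
      by (rule holomorphic_on_subset[OF K_fun_holomorphic]) (use sub in auto)
    have "norm ((deriv ^^ 1) (K_fun q \<omega>) z) \<le> fact 1 * (2 * M / \<omega>) / (\<rho> / 8) ^ 1"
    proof (rule Cauchy_inequality)
      show "K_fun q \<omega> holomorphic_on ball z (\<rho> / 8)"
        by (rule holomorphic_on_subset[OF hol]) auto
      show "continuous_on (cball z (\<rho> / 8)) (K_fun q \<omega>)"
        by (rule holomorphic_on_imp_continuous_on[OF hol])
      fix x :: complex assume "norm (z - x) = \<rho> / 8"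
      then have "x \<in> cball z (\<rho> / 8)" by (simp add: dist_norm)
      from sub[OF this] show "norm (K_fun q \<omega> x) \<le> 2 * M / \<omega>"
        by (intro K_fun_bound_near_0 l) auto
    qed (use rho_pos in auto)
    moreover have "fact 1 * (2 * M / \<omega>) / (\<rho> / 8) ^ 1 = 16 * (M / \<omega>) / \<rho>" by simp
    ultimately have "norm ((deriv ^^ 1) (K_fun q \<omega>) z) \<le> 1 / 2" using l(3) by linarith
    then show ?thesis by simp
  qed
  then show "cmod (deriv (K_fun q \<omega>) z) \<le> 1 / 2" using assms by blast
  show "cmod (K_fun q \<omega> z - K_fun q \<omega> w) \<le> 1 / 2 * cmod (z - w)"
  proof (rule field_differentiable_bound[of "cball 0 (\<rho> / 2)"])
    fix x :: complex assume x: "x \<in> cball 0 (\<rho> / 2)"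
    then have "Re x > - \<nu>" using abs_Re_le_cmod[of x] rho_pos by (auto simp: \<nu>_def)
    then show "(K_fun q \<omega> has_field_derivative deriv (K_fun q \<omega>) x) (at x within cball 0 (\<rho> / 2))"
      using holomorphic_derivI[OF K_fun_holomorphic op] by auto
    show "cmod (deriv (K_fun q \<omega>) x) \<le> 1 / 2" using bd x by simp
  qed (use assms in auto)
qed

section \<open>Existence, simplicity and uniqueness of the pole\<close>

lemma ex_real_zero:
  assumes "large \<omega>"
  obtains p :: real where "\<bar>p\<bar> \<le> 2 * M / \<omega>" "of_real p + K_fun q \<omega> (of_real p) = 0"
proof -
  note l = largeD[OF assms]
  have small: "cmod (K_fun q \<omega> (of_real x)) \<le> 2 * M / \<omega>" if "\<bar>x\<bar> \<le> \<rho> / 2" for x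
    by (rule K_fun_bound_near_0) (use that l rho_pos in auto)
  \<comment> \<open>As |K| \<le> \<rho>/16 on this interval, x + K x changes sign between the
    endpoints. The zero is then located more sharply by |p| = |K p|.\<close>
  have "continuous_on {- \<rho> / 2..\<rho> / 2} (\<lambda>x. Re (of_real x + K_fun q \<omega> (of_real x)))"
  proof (intro continuous_intros continuous_on_compose2[OF holomorphic_on_imp_continuous_on[OF K_fun_holomorphic]])
    show "complex_of_real ` {- \<rho> / 2..\<rho> / 2} \<subseteq> {z. - \<nu> < Re z}"
      using rho_pos by (auto simp: \<nu>_def)
  qed
  moreover have "Re (of_real (- \<rho> / 2) + K_fun q \<omega> (of_real (- \<rho> / 2))) \<le> 0"
    using small[of "- \<rho> / 2"] abs_Re_le_cmod[of "K_fun q \<omega> (of_real (- \<rho> / 2))"] l(2) rho_pos by simp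
  moreover have "Re (of_real (\<rho> / 2) + K_fun q \<omega> (of_real (\<rho> / 2))) \<ge> 0"
    using small[of "\<rho> / 2"] abs_Re_le_cmod[of "K_fun q \<omega> (of_real (\<rho> / 2))"] l(2) rho_pos by simp
  ultimately obtain p where p: "- \<rho> / 2 \<le> p" "p \<le> \<rho> / 2" "Re (of_real p + K_fun q \<omega> (of_real p)) = 0"
    using IVT'[of "\<lambda>x. Re (of_real x + K_fun q \<omega> (of_real x))" "- \<rho> / 2" 0 "\<rho> / 2"] rho_pos by auto
  then have 0: "of_real p + K_fun q \<omega> (of_real p) = 0"
    by (simp add: complex_eq_iff K_fun_of_real)
  then have "of_real p = - K_fun q \<omega> (of_real p)" by (simp add: add_eq_0_iff)
  then have "\<bar>p\<bar> = cmod (K_fun q \<omega> (of_real p))"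
    by (metis norm_minus_cancel norm_of_real)
  with small[of p] p have "\<bar>p\<bar> \<le> 2 * M / \<omega>" by simp
  with 0 that show ?thesis by blast
qed

lemma zero_imp_unique_simple_pole:
  assumes large: "large \<omega>" and p: "\<bar>p\<bar> \<le> 2 * M / \<omega>" "of_real p + K_fun q \<omega> (of_real p) = 0"
  shows "unique_simple_pole_at \<rho> q \<omega> p"
proof -
  note l = largeD[OF large]
  define S where "S = {z. Re z > - \<nu>}"
  define F where "F = (\<lambda>z. z + K_fun q \<omega> z)"
  have V: "V_fun q \<omega> = (\<lambda>z. 1 / F z)" by (simp add: V_fun_def F_def fun_eq_iff)
  have op: "open S" by (simp add: S_def open_halfspace_Re_gt)
  have F: "F holomorphic_on S"
    unfolding F_def S_def by (intro holomorphic_intros K_fun_holomorphic)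
  have p1: "\<bar>p\<bar> \<le> \<rho> / 16" using p l by linarith
  then have pS: "of_real p \<in> S" using rho_pos by (simp add: S_def \<nu>_def)
  have F0: "F (of_real p) = 0" using p by (simp add: F_def)
  have dF: "deriv F (of_real p) \<noteq> 0"
  proof
    assume "deriv F (of_real p) = 0"
    moreover have "deriv F (of_real p) = 1 + deriv (K_fun q \<omega>) (of_real p)"
      unfolding F_def
      by (subst deriv_add) (use pS op holomorphic_on_imp_differentiable_at[OF K_fun_holomorphic] in \<open>auto simp: S_def\<close>)
    ultimately have "cmod (deriv (K_fun q \<omega>) (of_real p)) = 1"
      by (metis add_eq_0_iff norm_minus_cancel norm_one)
    with K_fun_contraction(2)[OF large, of "of_real p" 0] p1 rho_pos show False by simp
  qed
  \<comment> \<open>The holomorphic cofactor in F z = (z - p) H z. It is nonzero at p because F' is,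
    so 1/H is the regular part that \<open>zorder_eqI\<close> asks for.\<close>
  define H where "H = (\<lambda>z. if z = of_real p then deriv F (of_real p) else (F z - F (of_real p)) / (z - of_real p))"
  have H: "H holomorphic_on S"
    unfolding H_def by (rule pole_lemma[OF F]) (use pS op interior_open in auto)
  define A where "A = {z \<in> S. H z \<noteq> 0}"
  have A: "open A"
  proof -
    have "A = S \<inter> H -` (- {0})" by (auto simp: A_def)
    then show ?thesis
      using continuous_open_preimage[OF holomorphic_on_imp_continuous_on[OF H] op, of "- {0}"]
      by (simp add: open_Compl)
  qed
  have pA: "of_real p \<in> A" using pS dF by (simp add: A_def H_def)
  have iH: "(\<lambda>z. 1 / H z) holomorphic_on A"
    by (intro holomorphic_intros holomorphic_on_subset[OF H]) (auto simp: A_def)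
  have VH: "V_fun q \<omega> w = 1 / H w / (w - of_real p) ^ 1" if "w \<noteq> of_real p" for w
    using that by (simp add: V H_def F0)
  have "is_pole (\<lambda>w. 1 / H w / (w - of_real p) ^ 1) (of_real p)"
    by (rule is_pole_basic[OF iH A pA]) (use pA in \<open>auto simp: A_def\<close>)
  moreover have "is_pole (V_fun q \<omega>) (of_real p) \<longleftrightarrow> is_pole (\<lambda>w. 1 / H w / (w - of_real p) ^ 1) (of_real p)"
    by (rule is_pole_cong) (use VH in \<open>auto simp: eventually_at_filter\<close>)
  ultimately have pole: "is_pole (V_fun q \<omega>) (of_real p)" by blast
  have "zorder (V_fun q \<omega>) (of_real p) = - 1"
  proof (rule zorder_eqI[OF A pA iH])
    show "1 / H (of_real p) \<noteq> 0" using pA by (simp add: A_def)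
    show "V_fun q \<omega> w = 1 / H w * (w - of_real p) powi - 1" if "w \<noteq> of_real p" for w
      using VH[OF that] by (simp add: power_int_minus field_simps)
  qed
  moreover have "z = of_real p" if z: "Re z \<ge> - \<rho> / 2" "is_pole (V_fun q \<omega>) z" for z
  proof -
    have zS: "z \<in> S" using z rho_pos by (simp add: S_def \<nu>_def)
    \<comment> \<open>Where F does not vanish, 1/F is holomorphic nearby, so a pole can only sit at
      a zero of F.\<close>
    have "F z = 0"
    proof (rule ccontr)
      assume nz: "F z \<noteq> 0"
      define A' where "A' = S \<inter> F -` (- {0})"
      have "open A'"
        unfolding A'_def by (intro continuous_open_preimage holomorphic_on_imp_continuous_on F op) auto
      moreover have "(\<lambda>z. 1 / F z) holomorphic_on A'"
        by (intro holomorphic_intros holomorphic_on_subset[OF F]) (auto simp: A'_def)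
      moreover have "z \<in> A'" using nz zS by (simp add: A'_def)
      ultimately show False using not_is_pole_holomorphic z(2) unfolding V by blast
    qed
    then have zK: "z = - K_fun q \<omega> z" by (simp add: F_def add_eq_0_iff)
    then have cz: "cmod z = cmod (K_fun q \<omega> z)" by (metis norm_minus_cancel)
    \<comment> \<open>A zero satisfies |z| = |K z|, which the half-plane bound keeps below
      \<omega>/2. The sharper bound near 0 then places z in the disc where K contracts.\<close>
    have "cmod z \<le> \<omega> / 2"
    proof (rule ccontr)
      assume "\<not> cmod z \<le> \<omega> / 2"
      with K_fun_bound[of z \<omega>] z l(5) cz rho_pos show False by simp
    qed
    then have "cmod z \<le> 2 * M / \<omega>"
      using K_fun_bound_near_0[of z \<omega>] z l(1) cz rho_pos by simp
    then have cz2: "cmod z \<le> \<rho> / 2" using l(2) rho_pos by linarith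
    have "z - of_real p = - (K_fun q \<omega> z - K_fun q \<omega> (of_real p))"
      using zK p(2) by (simp add: add_eq_0_iff)
    then have "cmod (z - of_real p) = cmod (K_fun q \<omega> z - K_fun q \<omega> (of_real p))"
      by (metis norm_minus_cancel)
    also have "\<dots> \<le> 1 / 2 * cmod (z - of_real p)"
      by (rule K_fun_contraction(1)[OF large cz2]) (use p1 rho_pos in simp)
    finally show "z = of_real p" by simp
  qed
  ultimately show ?thesis
    unfolding unique_simple_pole_at_def using pole p1 rho_pos by auto
qed

lemma unique_simple_pole_theta:
  assumes "large \<omega>"
  shows "unique_simple_pole_at \<rho> q \<omega> (- theta \<rho> q \<omega>)"
    and "\<bar>theta \<rho> q \<omega>\<bar> \<le> 2 * M / \<omega>"
    and "K_fun q \<omega> (of_real (- theta \<rho> q \<omega>)) = of_real (theta \<rho> q \<omega>)"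
proof -
  obtain p where p: "\<bar>p\<bar> \<le> 2 * M / \<omega>" "of_real p + K_fun q \<omega> (of_real p) = 0"
    using ex_real_zero[OF assms] .
  have u: "unique_simple_pole_at \<rho> q \<omega> p" by (rule zero_imp_unique_simple_pole[OF assms p])
  have "(THE p. unique_simple_pole_at \<rho> q \<omega> p) = p"
  proof (rule the_equality[where P="unique_simple_pole_at \<rho> q \<omega>", OF u])
    fix p' assume "unique_simple_pole_at \<rho> q \<omega> p'"
    then have "Re (of_real p') \<ge> - \<rho> / 2" "is_pole (V_fun q \<omega>) (of_real p')"
      by (auto simp: unique_simple_pole_at_def)
    with u have "complex_of_real p' = of_real p" unfolding unique_simple_pole_at_def by blast
    then show "p' = p" by simp
  qed
  then have "theta \<rho> q \<omega> = - p" by (simp add: theta_def)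
  with u p show "unique_simple_pole_at \<rho> q \<omega> (- theta \<rho> q \<omega>)" "\<bar>theta \<rho> q \<omega>\<bar> \<le> 2 * M / \<omega>"
    "K_fun q \<omega> (of_real (- theta \<rho> q \<omega>)) = of_real (theta \<rho> q \<omega>)"
    by (simp_all add: add_eq_0_iff)
qed

end

section \<open>The equation for the amplitude\<close>

context exp_profile
begin

text \<open>What the free evolution exp (i \<omega> t) \<open>\<psi>\<^sub>0\<close> contributes to
  the derivative of a.\<close>

definition forcing :: "real \<Rightarrow> (real \<Rightarrow> complex) \<Rightarrow> real \<Rightarrow> real" where
  "forcing \<omega> \<psi>\<^sub>0 t = - (1 / \<omega>) * Re (exp (\<i> * of_real (\<omega> * t)) * (LINT x|lborel. \<psi>\<^sub>0 x * of_real (q (x - t))))"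

lemma initial_correlation:
  assumes [measurable]: "\<psi>\<^sub>0 \<in> borel_measurable borel"
    and D: "\<And>x. exp (\<rho> * \<bar>x\<bar>) * cmod (\<psi>\<^sub>0 x) \<le> D"
  shows "integrable lborel (\<lambda>x. \<psi>\<^sub>0 x * of_real (q (x - t)))"
    and "cmod (LINT x|lborel. \<psi>\<^sub>0 x * of_real (q (x - t))) \<le> D * C * J * exp (- (\<nu> * \<bar>t\<bar>))"
proof -
  have D0: "D \<ge> 0" using order_trans[OF norm_ge_zero, of "\<psi>\<^sub>0 0" D] D[of 0] by simp
  have "cmod (\<psi>\<^sub>0 x) \<le> D * exp (- (\<rho> * \<bar>x\<bar>))" for x
    using D[of x] by (simp add: exp_minus field_simps)
  then have "cmod (\<psi>\<^sub>0 x) * \<bar>q (x - t)\<bar> \<le> (D * exp (- (\<rho> * \<bar>x\<bar>))) * (C * exp (- (\<rho> * \<bar>x - t\<bar>)))" for x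
    by (intro mult_mono q_bound) (auto simp: D0)
  then have AE: "AE x in lborel. cmod (\<psi>\<^sub>0 x * of_real (q (x - t))) \<le> D * C * exp (- (\<rho> * \<bar>x\<bar>)) * exp (- (\<rho> * \<bar>x + - t\<bar>))"
    by (simp add: norm_mult mult_ac)
  note * = correlation_bound[OF _ _ AE]
  show "integrable lborel (\<lambda>x. \<psi>\<^sub>0 x * of_real (q (x - t)))"
    by (rule *(1)) (auto simp: D0 C_nonneg)
  have "cmod (LINT x|lborel. \<psi>\<^sub>0 x * of_real (q (x - t))) \<le> D * C * J * exp (- (\<nu> * \<bar>- t\<bar>))"
    by (rule *(2)) (auto simp: D0 C_nonneg)
  then show "cmod (LINT x|lborel. \<psi>\<^sub>0 x * of_real (q (x - t))) \<le> D * C * J * exp (- (\<nu> * \<bar>t\<bar>))"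
    by simp
qed

lemma forcing_measurable [measurable]:
  assumes [measurable]: "\<psi>\<^sub>0 \<in> borel_measurable borel"
  shows "forcing \<omega> \<psi>\<^sub>0 \<in> borel_measurable borel"
  unfolding forcing_def[abs_def] by measurable

lemma forcing_bound:
  assumes "\<psi>\<^sub>0 \<in> borel_measurable borel" "\<And>x. exp (\<rho> * \<bar>x\<bar>) * cmod (\<psi>\<^sub>0 x) \<le> D" "\<omega> > 0" "t \<ge> 0"
  shows "\<bar>forcing \<omega> \<psi>\<^sub>0 t\<bar> \<le> D * C * J / \<omega> * exp (- (\<nu> * t))"
proof -
  let ?I = "LINT x|lborel. \<psi>\<^sub>0 x * of_real (q (x - t))"
  have "\<bar>forcing \<omega> \<psi>\<^sub>0 t\<bar> = \<bar>Re (exp (\<i> * of_real (\<omega> * t)) * ?I)\<bar> / \<omega>"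
    using assms(3) by (simp add: forcing_def abs_mult)
  also have "\<dots> \<le> cmod (exp (\<i> * of_real (\<omega> * t)) * ?I) / \<omega>"
    using assms(3) by (intro divide_right_mono abs_Re_le_cmod) auto
  also have "\<dots> = cmod ?I / \<omega>" by (simp add: norm_mult)
  also have "\<dots> \<le> D * C * J * exp (- (\<nu> * \<bar>t\<bar>)) / \<omega>"
    using assms(3) by (intro divide_right_mono initial_correlation assms) auto
  finally show ?thesis using assms(4) by simp
qed

text \<open>Integrating out x before s leaves the autocorrelation at t - s, which closes the
  equation for the amplitude alone.\<close>

lemma memory_Fubini:
  fixes a :: "real \<Rightarrow> real"
  assumes a: "continuous_on UNIV a" and t: "t \<ge> 0"
  shows "integrable lborel (\<lambda>x. (LINT s:{0..t}|lborel. cos (\<omega> * (t - s)) * a s * q (x - s)) * q (x - t))"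
    and "(LINT x|lborel. (LINT s:{0..t}|lborel. cos (\<omega> * (t - s)) * a s * q (x - s)) * q (x - t)) =
      (LINT s:{0..t}|lborel. cos (\<omega> * (t - s)) * g (t - s) * a s)"
proof -
  have [measurable]: "a \<in> borel_measurable borel" by (intro borel_measurable_continuous_onI a)
  have "compact (a ` {0..t})"
    by (intro compact_continuous_image continuous_on_subset[OF a]) auto
  then have "bounded (a ` {0..t})" by (rule compact_imp_bounded)
  then obtain A where "\<forall>y\<in>a ` {0..t}. norm y \<le> A" unfolding bounded_iff by blast
  then have A: "\<bar>a s\<bar> \<le> A" if "s \<in> {0..t}" for s using that by auto
  have A0: "A \<ge> 0" using A[of 0] t by auto
  define W where "W = (\<lambda>x s. indicator {0..t} s * (cos (\<omega> * (t - s)) * a s * q (x - s) * q (x - t)))"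
  have int: "integrable (lborel \<Otimes>\<^sub>M lborel) (case_prod W)"
  proof (rule dominated_integral(1))
    show "case_prod W \<in> borel_measurable (lborel \<Otimes>\<^sub>M lborel)"
      unfolding W_def by measurable
    have "integrable lborel (\<lambda>x. exp (- (\<rho> * \<bar>x - t\<bar>)))"
      using lborel_integrable_real_affine[OF integrable_exp_neg_abs[OF rho_pos], of 1 "-t"] by simp
    then show "integrable (lborel \<Otimes>\<^sub>M lborel) (\<lambda>(x, s). (C * exp (- (\<rho> * \<bar>x - t\<bar>))) * (A * C * indicator {0..t} s))"
      by (intro integrable_times_lborel integrable_mult_right integrable_indicator_Icc)
    have "norm (W x s) \<le> (C * exp (- (\<rho> * \<bar>x - t\<bar>))) * (A * C * indicator {0..t} s)" for x s
    proof (cases "s \<in> {0..t}")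
      case True
      have "\<bar>q (x - s)\<bar> \<le> C * exp (- (\<rho> * \<bar>x - s\<bar>))" by (rule q_bound)
      also have "\<dots> \<le> C * 1" using C_nonneg rho_pos by (intro mult_left_mono) auto
      finally have "\<bar>q (x - s)\<bar> \<le> C" by simp
      then have "\<bar>cos (\<omega> * (t - s))\<bar> * \<bar>a s\<bar> * \<bar>q (x - s)\<bar> * \<bar>q (x - t)\<bar> \<le> 1 * A * C * (C * exp (- (\<rho> * \<bar>x - t\<bar>)))"
        using True A0 C_nonneg by (intro mult_mono A q_bound) auto
      with True show ?thesis by (simp add: W_def abs_mult mult_ac)
    next
      case False
      then show ?thesis by (simp add: W_def)
    qed
    then show "AE p in lborel \<Otimes>\<^sub>M lborel. norm (case_prod W p) \<le>
        (case p of (x, s) \<Rightarrow> (C * exp (- (\<rho> * \<bar>x - t\<bar>))) * (A * C * indicator {0..t} s))"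
      by auto
  qed
  have inner: "(LINT s|lborel. W x s) = (LINT s:{0..t}|lborel. cos (\<omega> * (t - s)) * a s * q (x - s)) * q (x - t)" for x
  proof -
    have "(LINT s|lborel. W x s) = (LINT s|lborel. (indicator {0..t} s *\<^sub>R (cos (\<omega> * (t - s)) * a s * q (x - s))) * q (x - t))"
      by (intro Bochner_Integration.integral_cong) (auto simp: W_def)
    also have "\<dots> = (LINT s:{0..t}|lborel. cos (\<omega> * (t - s)) * a s * q (x - s)) * q (x - t)"
      unfolding set_lebesgue_integral_def by (rule integral_mult_left_zero)
    finally show ?thesis .
  qed
  have outer: "(LINT x|lborel. W x s) = indicator {0..t} s *\<^sub>R (cos (\<omega> * (t - s)) * g (t - s) * a s)" for s
  proof -
    have "(LINT x|lborel. W x s) = (LINT x|lborel. (indicator {0..t} s * (cos (\<omega> * (t - s)) * a s)) * (q (x - s) * q (x - t)))"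
      by (intro Bochner_Integration.integral_cong) (auto simp: W_def)
    also have "\<dots> = (indicator {0..t} s * (cos (\<omega> * (t - s)) * a s)) * (LINT x|lborel. q (x - s) * q (x - t))"
      by (rule integral_mult_right_zero)
    also have "(LINT x|lborel. q (x - s) * q (x - t)) = g (t - s)"
      using lborel_integral_real_affine[of 1 "\<lambda>x. q (x - s) * q (x - t)" t]
      by (simp add: g_def autocorr_def algebra_simps)
    finally show ?thesis by (simp add: mult_ac)
  qed
  show "integrable lborel (\<lambda>x. (LINT s:{0..t}|lborel. cos (\<omega> * (t - s)) * a s * q (x - s)) * q (x - t))"
    using lborel_pair.integrable_fst[OF int] by (simp add: inner)
  show "(LINT x|lborel. (LINT s:{0..t}|lborel. cos (\<omega> * (t - s)) * a s * q (x - s)) * q (x - t)) =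
      (LINT s:{0..t}|lborel. cos (\<omega> * (t - s)) * g (t - s) * a s)"
    using lborel_pair.Fubini_integral[OF int] by (simp add: inner outer set_lebesgue_integral_def)
qed

lemma duhamel_integrable:
  fixes a :: "real \<Rightarrow> real"
  assumes a: "continuous_on UNIV a"
  shows "set_integrable lborel {0..t} (\<lambda>s. exp (\<i> * of_real (\<omega> * (t - s))) * complex_of_real (a s * q (x - s)))"
proof -
  have [measurable]: "a \<in> borel_measurable borel" by (intro borel_measurable_continuous_onI a)
  show ?thesis
  proof (rule dominated_set_integral(1))
    show "set_integrable lborel {0..t} (\<lambda>s. \<bar>a s\<bar> * C)"
      by (intro borel_integrable_atLeastAtMost' continuous_intros continuous_on_subset[OF a]) auto
    fix s assume "s \<in> {0..t}"
    have "\<bar>q (x - s)\<bar> \<le> C * exp (- (\<rho> * \<bar>x - s\<bar>))" by (rule q_bound)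
    also have "\<dots> \<le> C * 1" using C_nonneg rho_pos by (intro mult_left_mono) auto
    finally have "\<bar>q (x - s)\<bar> \<le> C" by simp
    then show "norm (exp (\<i> * of_real (\<omega> * (t - s))) * complex_of_real (a s * q (x - s))) \<le> \<bar>a s\<bar> * C"
      by (auto simp: norm_mult abs_mult intro!: mult_left_mono)
  qed measurable
qed

lemma duhamel_nonneg:
  assumes "t \<ge> 0"
  shows "duhamel \<omega> q \<psi>\<^sub>0 a x t = exp (\<i> * of_real (\<omega> * t)) * \<psi>\<^sub>0 x +
     of_real \<omega> * (LINT s:{0..t}|lborel. exp (\<i> * of_real (\<omega> * (t - s))) * of_real (a s * q (x - s)))"
  using assms by (simp add: duhamel_def interval_integral_Icc zero_ereal_def)

text \<open>Duhamel's formula is inserted into the equation for a. The free part gives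
  \<open>forcing\<close>, the memory part a convolution, and the factor \<omega> in Duhamel's
  formula cancels the 1/\<omega> of the system.\<close>

lemma solution_amplitude:
  assumes sol: "solution \<omega> q \<psi>\<^sub>0 a\<^sub>0 \<psi> a" and \<omega>: "\<omega> > 0"
    and [measurable]: "\<psi>\<^sub>0 \<in> borel_measurable borel" and D: "\<And>x. exp (\<rho> * \<bar>x\<bar>) * cmod (\<psi>\<^sub>0 x) \<le> D"
  obtains a' where "\<And>t. (a has_real_derivative a' t) (at t)" "continuous_on UNIV a'" "a 0 = a\<^sub>0"
    "\<And>t. t \<ge> 0 \<Longrightarrow> a' t = forcing \<omega> \<psi>\<^sub>0 t - (LINT s:{0..t}|lborel. cos (\<omega> * (t - s)) * g (t - s) * a s)"
proof -
  from sol obtain \<psi>' a' where *: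
    "\<And>t. (a has_real_derivative a' t) (at t)" "continuous_on UNIV a'"
    "\<And>t. a' t = - (1 / \<omega>) * (LINT x|lborel. Re (\<psi> x t) * q (x - t))" "a 0 = a\<^sub>0"
    and \<psi>: "\<And>x t. \<psi> x t = duhamel \<omega> q \<psi>\<^sub>0 a x t"
    unfolding solution_def C1_solution_def by blast
  have ca: "continuous_on UNIV a"
    using *(1) by (auto simp: continuous_on_eq_continuous_at intro: DERIV_isCont)
  have "a' t = forcing \<omega> \<psi>\<^sub>0 t - (LINT s:{0..t}|lborel. cos (\<omega> * (t - s)) * g (t - s) * a s)" if t: "t \<ge> 0" for t
  proof -
    let ?e = "exp (\<i> * of_real (\<omega> * t))"
    let ?m = "\<lambda>x. LINT s:{0..t}|lborel. cos (\<omega> * (t - s)) * a s * q (x - s)"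
    have re: "Re (LINT s:{0..t}|lborel. exp (\<i> * of_real (\<omega> * (t - s))) * of_real (a s * q (x - s))) = ?m x" for x
    proof -
      have "Re (LINT s:{0..t}|lborel. exp (\<i> * of_real (\<omega> * (t - s))) * of_real (a s * q (x - s))) =
        (LINT s|lborel. Re (indicator {0..t} s *\<^sub>R (exp (\<i> * of_real (\<omega> * (t - s))) * of_real (a s * q (x - s)))))"
        unfolding set_lebesgue_integral_def
        by (rule integral_Re[symmetric]) (rule duhamel_integrable[OF ca, unfolded set_integrable_def])
      also have "\<dots> = ?m x"
        unfolding set_lebesgue_integral_def
        by (intro Bochner_Integration.integral_cong) (auto simp: Re_exp mult.assoc)
      finally show ?thesis .
    qed
    have split: "Re (\<psi> x t) * q (x - t) = Re (?e * (\<psi>\<^sub>0 x * of_real (q (x - t)))) + \<omega> * (?m x * q (x - t))" for x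
    proof -
      have "Re (of_real \<omega> * w) = \<omega> * Re w" for w by simp
      then show ?thesis
        unfolding \<psi> duhamel_nonneg[OF t] plus_complex.sel re[symmetric] by (simp add: algebra_simps)
    qed
    have i1: "integrable lborel (\<lambda>x. ?e * (\<psi>\<^sub>0 x * of_real (q (x - t))))"
      by (intro integrable_mult_right initial_correlation[OF _ D]) auto
    have "(LINT x|lborel. Re (\<psi> x t) * q (x - t)) =
        (LINT x|lborel. Re (?e * (\<psi>\<^sub>0 x * of_real (q (x - t))))) + (LINT x|lborel. \<omega> * (?m x * q (x - t)))"
      unfolding split
      by (intro Bochner_Integration.integral_add integrable_Re i1 integrable_mult_right memory_Fubini ca t)
    also have "(LINT x|lborel. Re (?e * (\<psi>\<^sub>0 x * of_real (q (x - t))))) = Re (?e * (LINT x|lborel. \<psi>\<^sub>0 x * of_real (q (x - t))))"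
      using integral_Re[OF i1] by simp
    also have "(LINT x|lborel. \<omega> * (?m x * q (x - t))) = \<omega> * (LINT s:{0..t}|lborel. cos (\<omega> * (t - s)) * g (t - s) * a s)"
      using memory_Fubini(2)[OF ca t] by simp
    finally show ?thesis
      using \<omega> unfolding *(3) forcing_def by (simp add: field_simps)
  qed
  with * that show ?thesis by blast
qed

end

section \<open>The Volterra equation with small kernel and the limit of the weighted
  amplitude\<close>

locale exp_profile_large = exp_profile +
  fixes \<omega> :: real
  assumes large: "large \<omega>"
begin

definition \<theta> :: real where "\<theta> = theta \<rho> q \<omega>"

definition k :: "real \<Rightarrow> real" where "k t = exp (\<theta> * t) * (cos (\<omega> * t) * g t)"

definition \<kappa> :: "real \<Rightarrow> real" where "\<kappa> T = (LINT t:{T..}|lborel. k t)"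

definition I :: real where "I = (LINT u:{0..}|lborel. \<kappa> u)"

lemma omega_pos: "\<omega> > 0"
  using large by (simp add: large_def)

lemma theta_bound: "\<bar>\<theta>\<bar> \<le> \<rho> / 16"
  using unique_simple_pole_theta(2)[OF large] largeD(2)[OF large] unfolding \<theta>_def by linarith

lemma rate_pos: "\<nu> - \<theta> \<ge> \<rho> / 2" "\<nu> - \<theta> > 0"
  using theta_bound rho_pos unfolding \<nu>_def by linarith+

lemma k_measurable [measurable]: "k \<in> borel_measurable borel"
  unfolding k_def[abs_def] by measurable

lemma k_bound:
  assumes "t \<ge> 0"
  shows "\<bar>k t\<bar> \<le> G * exp (- ((\<nu> - \<theta>) * t))"
proof -
  have "exp (\<theta> * t) * (\<bar>cos (\<omega> * t)\<bar> * \<bar>g t\<bar>) \<le> exp (\<theta> * t) * (1 * (G * exp (- (\<nu> * t))))"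
    by (intro mult_left_mono mult_mono g_bound assms) auto
  also have "\<dots> = G * exp (- ((\<nu> - \<theta>) * t))"
    by (simp add: algebra_simps flip: exp_add)
  finally show ?thesis by (simp add: k_def abs_mult)
qed

lemma k_integrable: "T \<ge> 0 \<Longrightarrow> set_integrable lborel {T..} k"
  by (rule exp_dominated_tail(1)[OF k_measurable rate_pos(2), where A=G]) (use k_bound in auto)

lemma kappa_measurable [measurable]: "\<kappa> \<in> borel_measurable borel"
proof -
  have "\<kappa> = (\<lambda>T. LINT t|lborel. (if T \<le> t then 1 else 0) * k t)"
    unfolding \<kappa>_def set_lebesgue_integral_def
    by (intro ext Bochner_Integration.integral_cong) (auto simp: indicator_def)
  then show ?thesis by simp
qed

text \<open>Writing the cosine as the real part of one exponential places the whole tail at a single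
  point with imaginary part - \<omega>, where \<open>B\<close> is O(1/\<omega>).\<close>

lemma kappa_eq_B:
  assumes "T \<ge> 0"
  shows "\<kappa> T = Re (B T (- of_real \<theta> - \<i> * of_real \<omega>))"
proof -
  have "set_integrable lborel {T..} (\<lambda>t. exp (- (- of_real \<theta> - \<i> * of_real \<omega>) * of_real t) * complex_of_real (g t))"
    by (rule B_integrable[OF assms]) (use rate_pos in simp)
  from integral_Re[OF this[unfolded set_integrable_def]]
  have "Re (B T (- of_real \<theta> - \<i> * of_real \<omega>)) = (LINT t|lborel. Re (indicator {T..} t *\<^sub>R
     (exp (- (- of_real \<theta> - \<i> * of_real \<omega>) * of_real t) * complex_of_real (g t))))"
    by (simp add: B_def set_lebesgue_integral_def)
  also have "\<dots> = \<kappa> T"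
    unfolding \<kappa>_def set_lebesgue_integral_def
    by (intro Bochner_Integration.integral_cong) (auto simp: k_def Re_exp)
  finally show ?thesis by simp
qed

lemma kappa_bound:
  assumes "T \<ge> 0"
  shows "\<bar>\<kappa> T\<bar> \<le> M / \<omega> * exp (- ((\<nu> - \<theta>) * T))"
proof -
  let ?z = "- of_real \<theta> - \<i> * of_real \<omega> :: complex"
  have "\<omega> * cmod (B T ?z) \<le> cmod ?z * cmod (B T ?z)"
    using abs_Im_le_cmod[of ?z] omega_pos by (intro mult_right_mono) auto
  also have "\<dots> \<le> M * exp (- ((\<nu> + Re ?z) * T))"
    by (rule B_bound_M[OF assms]) (use theta_bound rho_pos in simp)
  finally have "cmod (B T ?z) \<le> M / \<omega> * exp (- ((\<nu> - \<theta>) * T))"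
    using omega_pos by (simp add: field_simps)
  with abs_Re_le_cmod[of "B T ?z"] show ?thesis by (simp add: kappa_eq_B[OF assms])
qed

lemma kappa_0: "\<kappa> 0 = \<theta>"
proof -
  have "complex_of_real (\<kappa> 0) = of_real \<theta>"
    using unique_simple_pole_theta(3)[OF large] unfolding K_fun_of_real
    by (simp add: \<kappa>_def k_def \<theta>_def)
  then show ?thesis by simp
qed

lemma integral_k: "u \<ge> 0 \<Longrightarrow> (LINT t:{0..u}|lborel. k t) = \<theta> - \<kappa> u"
  using set_integral_split_tail(2)[OF k_integrable[of 0], of u] kappa_0 by (simp add: \<kappa>_def)

lemma kappa_tail:
  assumes "T \<ge> 0"
  shows "set_integrable lborel {T..} \<kappa>"
    and "\<bar>LINT u:{T..}|lborel. \<kappa> u\<bar> \<le> M / \<omega> * exp (- ((\<nu> - \<theta>) * T)) / (\<nu> - \<theta>)"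
  using exp_dominated_tail[OF kappa_measurable rate_pos(2), of T "M / \<omega>"] kappa_bound assms by auto

lemma I_bound: "\<bar>I\<bar> \<le> 2 * M / \<rho> / \<omega>" "\<bar>I\<bar> \<le> 1 / 2"
proof -
  have "\<bar>I\<bar> \<le> M / \<omega> / (\<nu> - \<theta>)"
    using kappa_tail(2)[of 0] by (simp add: I_def)
  also have "\<dots> \<le> M / \<omega> / (\<rho> / 2)"
    using rate_pos rho_pos M_nonneg omega_pos by (intro divide_left_mono) auto
  finally show 1: "\<bar>I\<bar> \<le> 2 * M / \<rho> / \<omega>" by (simp add: mult_ac)
  have "16 * (M / \<omega>) / \<rho> = 8 * (2 * M / \<rho> / \<omega>)" by simp
  then have "2 * M / \<rho> / \<omega> \<le> 1 / 16" using largeD(3)[OF large] by linarith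
  with 1 show "\<bar>I\<bar> \<le> 1 / 2" by linarith
qed

text \<open>By Fubini \<open>I\<close> is the first moment of \<open>k\<close>, that is, minus the
  derivative of \<open>K_fun\<close> at - \<theta>.\<close>

definition r :: real where "r = 1 / (1 - I)"

lemma r_bound: "\<bar>r - 1\<bar> \<le> 4 * M / \<rho> * (1 / \<omega>)"
proof -
  have "1 - I \<ge> 1 / 2" using I_bound by linarith
  then have "\<bar>r - 1\<bar> = \<bar>I\<bar> / (1 - I)" by (simp add: r_def field_simps abs_if)
  also have "\<dots> \<le> \<bar>I\<bar> / (1 / 2)" using \<open>1 - I \<ge> 1 / 2\<close> by (intro divide_left_mono) auto
  also have "\<dots> \<le> 4 * M / \<rho> * (1 / \<omega>)" using I_bound(1) by simp
  finally show ?thesis .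
qed

text \<open>Formally the Laplace transform of a is \<open>V_fun\<close> times
  (\<open>a\<^sub>0\<close> + the transform of \<open>forcing\<close>). The second factor at -
  \<theta> is \<beta>, so the residue there is \<beta> r.\<close>

definition \<beta> :: "(real \<Rightarrow> complex) \<Rightarrow> real \<Rightarrow> real" where
  "\<beta> \<psi>\<^sub>0 a\<^sub>0 = a\<^sub>0 + (LINT t:{0..}|lborel. exp (\<theta> * t) * forcing \<omega> \<psi>\<^sub>0 t)"

lemma beta_zero: "\<beta> (\<lambda>_. 0) a\<^sub>0 = a\<^sub>0"
  by (simp add: \<beta>_def forcing_def)

lemma weighted_forcing_bound:
  assumes "\<psi>\<^sub>0 \<in> borel_measurable borel" "\<And>x. exp (\<rho> * \<bar>x\<bar>) * cmod (\<psi>\<^sub>0 x) \<le> D" "t \<ge> 0"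
  shows "\<bar>exp (\<theta> * t) * forcing \<omega> \<psi>\<^sub>0 t\<bar> \<le> D * C * J / \<omega> * exp (- ((\<nu> - \<theta>) * t))"
proof -
  have "exp (\<theta> * t) * \<bar>forcing \<omega> \<psi>\<^sub>0 t\<bar> \<le> exp (\<theta> * t) * (D * C * J / \<omega> * exp (- (\<nu> * t)))"
    by (intro mult_left_mono forcing_bound assms omega_pos) auto
  also have "\<dots> = D * C * J / \<omega> * exp (- ((\<nu> - \<theta>) * t))"
    by (simp add: algebra_simps flip: exp_add)
  finally show ?thesis by (simp add: abs_mult)
qed

text \<open>The defining equation of \<open>\<theta>\<close> says that \<open>k\<close> has integral \<open>\<theta>\<close>; hence for \<open>b t = exp (\<theta> t) a t\<close> the equation
  \<open>b' = \<theta> b - k * b + f\<close> is the derivative of a Volterra equation with the small kernel \<open>\<kappa>\<close>.\<close>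

lemma volterra_equation:
  assumes \<psi>\<^sub>0 [measurable]: "\<psi>\<^sub>0 \<in> borel_measurable borel" and D: "\<And>x. exp (\<rho> * \<bar>x\<bar>) * cmod (\<psi>\<^sub>0 x) \<le> D"
    and a: "\<And>t. (a has_real_derivative a' t) (at t)" "continuous_on UNIV a'" "a 0 = a\<^sub>0"
      "\<And>t. t \<ge> 0 \<Longrightarrow> a' t = forcing \<omega> \<psi>\<^sub>0 t - (LINT s:{0..t}|lborel. cos (\<omega> * (t - s)) * g (t - s) * a s)"
    and T: "T \<ge> 0"
  shows "exp (\<theta> * T) * a T = a\<^sub>0 + (LINT t:{0..T}|lborel. exp (\<theta> * t) * forcing \<omega> \<psi>\<^sub>0 t)
     + (LINT s:{0..T}|lborel. \<kappa> (T - s) * (exp (\<theta> * s) * a s))"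
proof -
  define b where "b = (\<lambda>t. exp (\<theta> * t) * a t)"
  define b' where "b' = (\<lambda>t. exp (\<theta> * t) * (a' t + \<theta> * a t))"
  have ca: "continuous_on UNIV a"
    using a(1) by (auto simp: continuous_on_eq_continuous_at intro: DERIV_isCont)
  have cb: "continuous_on UNIV b" unfolding b_def by (intro continuous_intros ca)
  have cb': "continuous_on UNIV b'" unfolding b'_def by (intro continuous_intros ca a)
  have [measurable]: "b \<in> borel_measurable borel" by (intro borel_measurable_continuous_onI cb)
  have db: "(b has_real_derivative b' t) (at t)" for t
    unfolding b_def b'_def by (rule derivative_eq_intros a(1) refl)+ (simp add: algebra_simps)
  have "compact (b ` {0..T})"
    by (intro compact_continuous_image continuous_on_subset[OF cb]) auto
  then have "bounded (b ` {0..T})" by (rule compact_imp_bounded)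
  then obtain Bb where "\<forall>y\<in>b ` {0..T}. norm y \<le> Bb" unfolding bounded_iff by blast
  then have Bb: "\<bar>b s\<bar> \<le> Bb" if "s \<in> {0..T}" for s using that by auto
  have Bk: "\<bar>k u\<bar> \<le> G" if "u \<in> {0..T}" for u
  proof -
    have "\<bar>k u\<bar> \<le> G * exp (- ((\<nu> - \<theta>) * u))" using that by (intro k_bound) auto
    also have "\<dots> \<le> G * 1"
      using rate_pos that G_nonneg by (intro mult_left_mono) auto
    finally show ?thesis by simp
  qed
  note Fub = convolution_Fubini[OF k_measurable \<open>b \<in> borel_measurable borel\<close> Bk Bb]
  have ib: "set_integrable lborel {0..T} b"
    by (intro borel_integrable_atLeastAtMost' continuous_on_subset[OF cb]) auto
  have if1: "set_integrable lborel {0..T} (\<lambda>t. exp (\<theta> * t) * forcing \<omega> \<psi>\<^sub>0 t)"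
  proof (rule set_integrable_subset)
    show "set_integrable lborel {0..} (\<lambda>t. exp (\<theta> * t) * forcing \<omega> \<psi>\<^sub>0 t)"
      by (rule exp_dominated_tail(1)[OF _ rate_pos(2), where A="D * C * J / \<omega>"])
        (use weighted_forcing_bound[OF \<psi>\<^sub>0 D] in auto)
  qed auto
  have b'_eq: "b' t = \<theta> * b t + exp (\<theta> * t) * forcing \<omega> \<psi>\<^sub>0 t - (LINT s:{0..t}|lborel. k (t - s) * b s)"
    if "t \<in> {0..T}" for t
  proof -
    define Y where "Y = (LINT s:{0..t}|lborel. cos (\<omega> * (t - s)) * g (t - s) * a s)"
    define Z where "Z = (LINT s:{0..t}|lborel. k (t - s) * b s)"
    have "exp (\<theta> * t) * Y =
      (LINT s:{0..t}|lborel. exp (\<theta> * t) * (cos (\<omega> * (t - s)) * g (t - s) * a s))"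
      by (simp add: Y_def)
    also have "\<dots> = Z"
      unfolding Z_def
    proof (intro set_lebesgue_integral_cong allI impI)
      fix s
      have "exp (\<theta> * t) = exp (\<theta> * (t - s)) * exp (\<theta> * s)" by (simp add: algebra_simps flip: exp_add)
      then show "exp (\<theta> * t) * (cos (\<omega> * (t - s)) * g (t - s) * a s) = k (t - s) * b s"
        by (simp add: k_def b_def mult_ac)
    qed auto
    finally have YZ: "exp (\<theta> * t) * Y = Z" .
    have fY: "forcing \<omega> \<psi>\<^sub>0 t = a' t + Y" using that a(4)[of t] by (simp add: Y_def)
    show ?thesis unfolding Z_def[symmetric] YZ[symmetric] fY by (simp add: b'_def b_def algebra_simps)
  qed
  have "b T - b 0 = (LINT t:{0..T}|lborel. b' t)"
    using integral_FTC_Icc_real[OF T db] cb' by (simp add: continuous_on_eq_continuous_at set_lebesgue_integral_def mult.commute)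
  also have "\<dots> = (LINT t:{0..T}|lborel. \<theta> * b t + exp (\<theta> * t) * forcing \<omega> \<psi>\<^sub>0 t - (LINT s:{0..t}|lborel. k (t - s) * b s))"
    by (intro set_lebesgue_integral_cong) (auto simp: b'_eq)
  also have "\<dots> = (LINT t:{0..T}|lborel. \<theta> * b t) + (LINT t:{0..T}|lborel. exp (\<theta> * t) * forcing \<omega> \<psi>\<^sub>0 t)
     - (LINT t:{0..T}|lborel. LINT s:{0..t}|lborel. k (t - s) * b s)"
    by (simp only: set_integral_diff set_integral_add set_integrable_mult_right ib if1 Fub(1))
  also have "(LINT t:{0..T}|lborel. LINT s:{0..t}|lborel. k (t - s) * b s) =
       (LINT s:{0..T}|lborel. (LINT u:{0..T - s}|lborel. k u) * b s)"
    by (rule Fub(2))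
  \<comment> \<open>The primitive of \<open>k\<close> is \<theta> - \<kappa>. Its constant part
    cancels the term \<theta> b created by the exponential weight, and only the small kernel
    survives.\<close>
  also have "\<dots> = (LINT s:{0..T}|lborel. \<theta> * b s - \<kappa> (T - s) * b s)"
    by (intro set_lebesgue_integral_cong) (auto simp: integral_k algebra_simps)
  also have "\<dots> = (LINT s:{0..T}|lborel. \<theta> * b s) - (LINT s:{0..T}|lborel. \<kappa> (T - s) * b s)"
  proof (rule set_integral_diff)
    show "set_integrable lborel {0..T} (\<lambda>s. \<theta> * b s)" by (intro set_integrable_mult_right ib)
    show "set_integrable lborel {0..T} (\<lambda>s. \<kappa> (T - s) * b s)"
    proof (rule dominated_set_integral(1))
      show "set_integrable lborel {0..T} (\<lambda>s. M / \<omega> * \<bar>b s\<bar>)"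
        by (intro set_integrable_mult_right set_integrable_abs ib)
      fix s assume s: "s \<in> {0..T}"
      have "\<bar>\<kappa> (T - s)\<bar> \<le> M / \<omega> * exp (- ((\<nu> - \<theta>) * (T - s)))" using s by (intro kappa_bound) auto
      also have "\<dots> \<le> M / \<omega> * 1"
        using rate_pos s M_nonneg omega_pos by (intro mult_left_mono) auto
      finally have "\<bar>\<kappa> (T - s)\<bar> \<le> M / \<omega>" by simp
      from mult_right_mono[OF this, of "\<bar>b s\<bar>"] show "norm (\<kappa> (T - s) * b s) \<le> M / \<omega> * \<bar>b s\<bar>"
        by (simp add: abs_mult)
    qed auto
  qed
  finally show ?thesis using a(3) by (simp add: b_def)
qed

text \<open>Once the expected limit is subtracted from the weighted amplitude, the constants cancel
  and the inhomogeneity consists of tails of the forcing and of \<kappa>. These decay exponentially,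
  so \<open>convolution_equation_decay\<close> applies.\<close>

lemma amplitude_decay:
  assumes \<psi>\<^sub>0 [measurable]: "\<psi>\<^sub>0 \<in> borel_measurable borel" and D: "\<And>x. exp (\<rho> * \<bar>x\<bar>) * cmod (\<psi>\<^sub>0 x) \<le> D"
    and sol: "solution \<omega> q \<psi>\<^sub>0 a\<^sub>0 \<psi> a"
  obtains E where "continuous_on UNIV a"
    "\<And>t. t \<ge> 0 \<Longrightarrow> \<bar>a t - \<beta> \<psi>\<^sub>0 a\<^sub>0 * r * exp (- \<theta> * t)\<bar> \<le> E * exp (- (\<rho> / 2 * t))"
proof -
  obtain a' where a': "\<And>t. (a has_real_derivative a' t) (at t)" "continuous_on UNIV a'" "a 0 = a\<^sub>0"
    "\<And>t. t \<ge> 0 \<Longrightarrow> a' t = forcing \<omega> \<psi>\<^sub>0 t - (LINT s:{0..t}|lborel. cos (\<omega> * (t - s)) * g (t - s) * a s)"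
    using solution_amplitude[OF sol omega_pos \<psi>\<^sub>0 D] by blast
  have volt: "exp (\<theta> * t) * a t = a\<^sub>0 + (LINT t:{0..t}|lborel. exp (\<theta> * t) * forcing \<omega> \<psi>\<^sub>0 t)
     + (LINT s:{0..t}|lborel. \<kappa> (t - s) * (exp (\<theta> * s) * a s))" if "t \<ge> 0" for t
    by (rule volterra_equation[OF \<psi>\<^sub>0 D a'(1-3)]) (use a'(4) that in auto)
  define f where "f = (\<lambda>t. exp (\<theta> * t) * forcing \<omega> \<psi>\<^sub>0 t)"
  have f_m: "f \<in> borel_measurable borel" unfolding f_def by measurable
  define A1 where "A1 = D * C * J / \<omega>"
  have fb: "\<bar>f t\<bar> \<le> A1 * exp (- ((\<nu> - \<theta>) * t))" if "t \<ge> 0" for t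
    unfolding f_def A1_def by (rule weighted_forcing_bound[OF \<psi>\<^sub>0 D that])
  have ft: "set_integrable lborel {T..} f"
    "\<bar>LINT t:{T..}|lborel. f t\<bar> \<le> A1 * exp (- ((\<nu> - \<theta>) * T)) / (\<nu> - \<theta>)" if "T \<ge> 0" for T
    using exp_dominated_tail[OF f_m rate_pos(2), of T A1] fb that by auto
  \<comment> \<open>The only possible limit: letting t tend to infinity in the Volterra equation
    gives R = \<beta> + I R.\<close>
  define R where "R = \<beta> \<psi>\<^sub>0 a\<^sub>0 * r"
  have R: "R * (1 - I) = \<beta> \<psi>\<^sub>0 a\<^sub>0"
    using I_bound(2) by (simp add: R_def r_def)
  define c where "c = (\<lambda>t. exp (\<theta> * t) * a t - R)"
  have ca: "continuous_on UNIV a"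
    using a'(1) by (auto simp: continuous_on_eq_continuous_at intro: DERIV_isCont)
  have cc: "continuous_on UNIV c" unfolding c_def by (intro continuous_intros ca)
  define F where "F = (\<lambda>t. - (LINT t:{t..}|lborel. f t) - R * (LINT u:{t..}|lborel. \<kappa> u))"
  define A where "A = (A1 + \<bar>R\<bar> * (M / \<omega>)) / (\<nu> - \<theta>)"
  have ceq: "c t = F t + (LINT s:{0..t}|lborel. \<kappa> (t - s) * c s)" if t: "t \<ge> 0" for t
  proof -
    have ik: "set_integrable lborel {0..t} (\<lambda>s. \<kappa> (t - s))"
    proof (rule dominated_set_integral(1))
      show "set_integrable lborel {0..t} (\<lambda>s. M / \<omega> * exp (- ((\<nu> - \<theta>) * (t - s))))"
        by (intro set_integrable_mult_right exp_convolution_le rate_pos t)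
      show "norm (\<kappa> (t - s)) \<le> M / \<omega> * exp (- ((\<nu> - \<theta>) * (t - s)))" if "s \<in> {0..t}" for s
        using that kappa_bound[of "t - s"] by auto
    qed auto
    have ikc: "set_integrable lborel {0..t} (\<lambda>s. \<kappa> (t - s) * c s)"
    proof (rule dominated_set_integral(1))
      have [measurable]: "c \<in> borel_measurable borel" by (intro borel_measurable_continuous_onI cc)
      show "(\<lambda>s. \<kappa> (t - s) * c s) \<in> borel_measurable lborel" by measurable
      show "set_integrable lborel {0..t} (\<lambda>s. M / \<omega> * exp (- ((\<nu> - \<theta>) * (t - s))) * \<bar>c s\<bar>)"
        by (intro borel_integrable_atLeastAtMost' continuous_intros continuous_on_subset[OF cc]) auto
      show "norm (\<kappa> (t - s) * c s) \<le> M / \<omega> * exp (- ((\<nu> - \<theta>) * (t - s))) * \<bar>c s\<bar>" if "s \<in> {0..t}" for s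
        using mult_right_mono[OF kappa_bound[of "t - s"], of "\<bar>c s\<bar>"] that by (simp add: abs_mult)
    qed auto
    have 1: "(LINT s:{0..t}|lborel. \<kappa> (t - s) * (exp (\<theta> * s) * a s)) =
        (LINT s:{0..t}|lborel. \<kappa> (t - s) * c s) + R * (I - (LINT u:{t..}|lborel. \<kappa> u))"
    proof -
      have "(LINT s:{0..t}|lborel. \<kappa> (t - s) * (exp (\<theta> * s) * a s)) =
        (LINT s:{0..t}|lborel. \<kappa> (t - s) * c s + R * \<kappa> (t - s))"
        by (intro set_lebesgue_integral_cong) (auto simp: c_def algebra_simps)
      also have "\<dots> = (LINT s:{0..t}|lborel. \<kappa> (t - s) * c s) + (LINT s:{0..t}|lborel. R * \<kappa> (t - s))"
        by (intro set_integral_add ikc set_integrable_mult_right ik)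
      also have "(LINT s:{0..t}|lborel. R * \<kappa> (t - s)) = R * (LINT u:{0..t}|lborel. \<kappa> u)"
        using set_integral_reflect_Icc[of t \<kappa>] by simp
      also have "(LINT u:{0..t}|lborel. \<kappa> u) = I - (LINT u:{t..}|lborel. \<kappa> u)"
        using set_integral_split_tail(2)[OF kappa_tail(1)[of 0] t] by (simp add: I_def)
      finally show ?thesis .
    qed
    have 2: "(LINT t:{0..t}|lborel. f t) = \<beta> \<psi>\<^sub>0 a\<^sub>0 - a\<^sub>0 - (LINT t:{t..}|lborel. f t)"
      using set_integral_split_tail(2)[OF ft(1)[of 0] t] by (simp add: \<beta>_def f_def)
    have "c t = \<beta> \<psi>\<^sub>0 a\<^sub>0 - (LINT t:{t..}|lborel. f t) + ((LINT s:{0..t}|lborel. \<kappa> (t - s) * c s)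
       + R * (I - (LINT u:{t..}|lborel. \<kappa> u))) - R"
      using volt[OF t] 2 unfolding 1 by (simp add: c_def f_def)
    then show ?thesis unfolding F_def R[symmetric] by (simp add: algebra_simps)
  qed
  have Fb: "\<bar>F t\<bar> \<le> A * exp (- ((\<rho> / 2 - \<theta>) * t))" if t: "t \<ge> 0" for t
  proof -
    have A1: "A1 \<ge> 0" using fb[of 0] by simp
    have "\<bar>F t\<bar> \<le> \<bar>LINT t:{t..}|lborel. f t\<bar> + \<bar>R\<bar> * \<bar>LINT u:{t..}|lborel. \<kappa> u\<bar>"
      unfolding F_def by (simp add: flip: abs_mult)
    also have "\<dots> \<le> A1 * exp (- ((\<nu> - \<theta>) * t)) / (\<nu> - \<theta>) + \<bar>R\<bar> * (M / \<omega> * exp (- ((\<nu> - \<theta>) * t)) / (\<nu> - \<theta>))"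
      by (intro add_mono ft kappa_tail mult_left_mono t) auto
    also have "\<dots> = A * exp (- ((\<nu> - \<theta>) * t))"
      by (simp add: A_def add_divide_distrib algebra_simps)
    \<comment> \<open>The rate is lowered from \<nu> - \<theta> to \<rho>/2 - \<theta> so that the
      kernel decays faster than the claim by \<delta> = \<rho>/4.\<close>
    also have "\<dots> \<le> A * exp (- ((\<rho> / 2 - \<theta>) * t))"
    proof (intro mult_left_mono)
      show "A \<ge> 0" using A1 M_nonneg omega_pos rate_pos by (simp add: A_def)
      have "(\<rho> / 2 - \<theta>) * t \<le> (\<nu> - \<theta>) * t"
        using rho_pos t by (intro mult_right_mono) (auto simp: \<nu>_def)
      then show "exp (- ((\<nu> - \<theta>) * t)) \<le> exp (- ((\<rho> / 2 - \<theta>) * t))" by simp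
    qed
    finally show ?thesis .
  qed
  have cb: "\<bar>c t\<bar> \<le> 2 * A * exp (- ((\<rho> / 2 - \<theta>) * t))" if "t \<ge> 0" for t
  proof (rule convolution_equation_decay[where \<delta>="\<rho> / 4" and \<epsilon>="M / \<omega>" and \<kappa>=\<kappa> and F=F])
    show "M / \<omega> \<le> \<rho> / 4 / 2"
      using largeD(2)[OF large] rho_pos by simp
    show "\<bar>\<kappa> u\<bar> \<le> M / \<omega> * exp (- ((\<rho> / 2 - \<theta> + \<rho> / 4) * u))" if "u \<ge> 0" for u
    proof -
      have "\<rho> / 2 - \<theta> + \<rho> / 4 = \<nu> - \<theta>" by (simp add: \<nu>_def)
      with kappa_bound[OF that] show ?thesis by simp
    qed
  qed (use rho_pos cc Fb ceq that in auto)
  have "\<bar>a t - R * exp (- \<theta> * t)\<bar> \<le> 2 * A * exp (- (\<rho> / 2 * t))" if "t \<ge> 0" for t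
  proof -
    have "a t - R * exp (- \<theta> * t) = exp (- \<theta> * t) * c t"
      by (simp add: c_def exp_minus field_simps)
    then have "\<bar>a t - R * exp (- \<theta> * t)\<bar> = exp (- \<theta> * t) * \<bar>c t\<bar>" by (simp add: abs_mult)
    also have "\<dots> \<le> exp (- \<theta> * t) * (2 * A * exp (- ((\<rho> / 2 - \<theta>) * t)))"
      by (intro mult_left_mono cb that) auto
    also have "\<dots> = 2 * A * exp (- (\<rho> / 2 * t))"
      by (simp add: algebra_simps flip: exp_add)
    finally show ?thesis .
  qed
  with that[OF ca] show ?thesis unfolding R_def by blast
qed

section \<open>The field in the moving frame\<close>

lemma duhamel_reflect:
  fixes a :: "real \<Rightarrow> real"
  assumes t: "t \<ge> 0"
  shows "duhamel \<omega> q \<psi>\<^sub>0 a (t + l) t = exp (\<i> * of_real (\<omega> * t)) * \<psi>\<^sub>0 (t + l) +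
     of_real \<omega> * (LINT u:{0..t}|lborel. exp (\<i> * of_real (\<omega> * u)) * of_real (a (t - u) * q (u + l)))"
proof -
  \<comment> \<open>With u = t - s the profile factor becomes q(u + l), free of t, as in the
    integrand of \<open>sigma_fun\<close>.\<close>
  have "(LINT s:{0..t}|lborel. exp (\<i> * of_real (\<omega> * (t - s))) * complex_of_real (a s * q (t + l - s))) =
      (LINT u:{0..t}|lborel. exp (\<i> * of_real (\<omega> * u)) * of_real (a (t - u) * q (u + l)))"
    using set_integral_reflect_Icc[of t "\<lambda>u. exp (\<i> * of_real (\<omega> * u)) * complex_of_real (a (t - u) * q (u + l))"]
    by (simp add: algebra_simps)
  then show ?thesis by (simp add: duhamel_nonneg[OF t])
qed

lemma q_shift_bound:
  assumes "u \<ge> 0"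
  shows "\<bar>q (u + l)\<bar> \<le> C * exp (\<rho> * \<bar>l\<bar>) * exp (- (\<rho> * u))"
proof -
  have "\<rho> * u - \<rho> * \<bar>l\<bar> \<le> \<rho> * \<bar>u + l\<bar>"
    using rho_pos assms unfolding right_diff_distrib[symmetric] by (intro mult_left_mono) auto
  then have "C * exp (- (\<rho> * \<bar>u + l\<bar>)) \<le> C * exp (\<rho> * \<bar>l\<bar> + - (\<rho> * u))"
    using C_nonneg by (intro mult_left_mono) auto
  with q_bound[of "u + l"] show ?thesis by (simp add: exp_add mult.assoc del: add_uminus_conv_diff)
qed

lemma sigma_integrand_bound:
  assumes "u \<ge> 0"
  shows "cmod (exp ((of_real \<theta> + \<i> * of_real \<omega>) * of_real u) * of_real (q (u + l)))
    \<le> C * exp (\<rho> * \<bar>l\<bar>) * exp (- ((\<rho> - \<theta>) * u))"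
proof -
  have "cmod (exp ((of_real \<theta> + \<i> * of_real \<omega>) * of_real u) * of_real (q (u + l))) = exp (\<theta> * u) * \<bar>q (u + l)\<bar>"
    by (simp add: norm_mult)
  also have "\<dots> \<le> exp (\<theta> * u) * (C * exp (\<rho> * \<bar>l\<bar>) * exp (- (\<rho> * u)))"
    by (intro mult_left_mono q_shift_bound assms) auto
  also have "\<dots> = C * exp (\<rho> * \<bar>l\<bar>) * exp (- ((\<rho> - \<theta>) * u))"
    by (simp add: algebra_simps flip: exp_add)
  finally show ?thesis .
qed

lemma sigma_tail:
  fixes t l :: real
  assumes "t \<ge> 0"
  defines "s \<equiv> (\<lambda>u. exp ((of_real \<theta> + \<i> * of_real \<omega>) * of_real u) * complex_of_real (q (u + l)))"
  shows "set_integrable lborel {t..} s"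
    and "cmod (LINT u:{t..}|lborel. s u) \<le> C * exp (\<rho> * \<bar>l\<bar>) * exp (- ((\<rho> - \<theta>) * t)) / (\<rho> - \<theta>)"
proof -
  have pos: "\<rho> - \<theta> > 0" using theta_bound rho_pos by linarith
  have m: "s \<in> borel_measurable borel" unfolding s_def by measurable
  have b: "norm (s u) \<le> C * exp (\<rho> * \<bar>l\<bar>) * exp (- ((\<rho> - \<theta>) * u))" if "t \<le> u" for u
    unfolding s_def by (rule sigma_integrand_bound) (use that assms in auto)
  show "set_integrable lborel {t..} s" by (rule exp_dominated_tail(1)[OF m pos b])
  show "cmod (LINT u:{t..}|lborel. s u) \<le> C * exp (\<rho> * \<bar>l\<bar>) * exp (- ((\<rho> - \<theta>) * t)) / (\<rho> - \<theta>)"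
    by (rule exp_dominated_tail(2)[OF m pos b])
qed

text \<open>The leading part of a in Duhamel's formula gives the integral of
  \<open>sigma_fun\<close> cut off at t. The error has three sources: the free evolution at t + l,
  the missing tail of \<open>sigma_fun\<close>, and the remainder of the amplitude. The bound
  depends on l through exp (\<rho> |l|), the cost of shifting the weights.\<close>

lemma solution_expansion:
  assumes \<psi>\<^sub>0: "\<psi>\<^sub>0 \<in> borel_measurable borel" and D: "\<And>x. exp (\<rho> * \<bar>x\<bar>) * cmod (\<psi>\<^sub>0 x) \<le> D"
    and sol: "solution \<omega> q \<psi>\<^sub>0 a\<^sub>0 \<psi> a"
  obtains H where "\<And>l t. t \<ge> 0 \<Longrightarrow>
     cmod (\<psi> (t + l) t - of_real (\<beta> \<psi>\<^sub>0 a\<^sub>0 * \<omega> * r) * sigma_fun \<rho> q \<omega> l * of_real (exp (- \<theta> * t)))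
       \<le> H l * exp (- (\<rho> / 2 * t))"
proof -
  define R where "R = \<beta> \<psi>\<^sub>0 a\<^sub>0 * r"
  define d where "d = (\<lambda>t. a t - R * exp (- \<theta> * t))"
  obtain E where ca: "continuous_on UNIV a" and E: "\<And>t. t \<ge> 0 \<Longrightarrow> \<bar>d t\<bar> \<le> E * exp (- (\<rho> / 2 * t))"
    using amplitude_decay[OF \<psi>\<^sub>0 D sol] unfolding d_def R_def by blast
  have cd: "continuous_on UNIV d" unfolding d_def by (intro continuous_intros ca)
  have [measurable]: "d \<in> borel_measurable borel" by (intro borel_measurable_continuous_onI cd)
  have E0: "E \<ge> 0" using E[of 0] by simp
  have D0: "D \<ge> 0" using order_trans[OF norm_ge_zero, of "\<psi>\<^sub>0 0" D] D[of 0] by simp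
  define Cl where "Cl = (\<lambda>l. C * exp (\<rho> * \<bar>l\<bar>))"
  have Cl0: "Cl l \<ge> 0" for l using C_nonneg by (simp add: Cl_def)
  define H where "H = (\<lambda>l. D * exp (\<rho> * \<bar>l\<bar>) + \<omega> * \<bar>R\<bar> * (Cl l / (\<rho> - \<theta>)) + \<omega> * (E * Cl l * (2 / \<rho>)))"
  have pos: "\<rho> - \<theta> > 0" using theta_bound rho_pos by linarith
  have "cmod (\<psi> (t + l) t - of_real (R * \<omega>) * sigma_fun \<rho> q \<omega> l * of_real (exp (- \<theta> * t))) \<le> H l * exp (- (\<rho> / 2 * t))"
    if t: "t \<ge> 0" for l t
  proof -
    define s where "s = (\<lambda>u. exp ((of_real \<theta> + \<i> * of_real \<omega>) * of_real u) * complex_of_real (q (u + l)))"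
    define w where "w = (\<lambda>u. exp (\<i> * of_real (\<omega> * u)) * complex_of_real (d (t - u) * q (u + l)))"
    define X where "X = (LINT u:{t..}|lborel. s u)"
    define Y where "Y = (LINT u:{0..t}|lborel. w u)"
    have is1: "set_integrable lborel {0..t} s"
      using set_integral_split_tail(1)[OF sigma_tail(1)[of 0 l]] t by (simp add: s_def)
    have sig: "sigma_fun \<rho> q \<omega> l = (LINT u:{0..t}|lborel. s u) + X"
      using set_integral_split_tail(2)[OF sigma_tail(1)[of 0 l] t]
      by (simp add: sigma_fun_def s_def X_def \<theta>_def)
    \<comment> \<open>The profile decays twice as fast as the remainder d, so after exp (- \<rho> t
      / 2) is taken out an integrable factor is left and no factor t appears.\<close>
    have wb: "norm (w u) \<le> E * Cl l * exp (- (\<rho> / 2 * t)) * exp (- (\<rho> / 2 * u))" if u: "u \<in> {0..t}" for u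
    proof -
      have "norm (w u) = \<bar>d (t - u)\<bar> * \<bar>q (u + l)\<bar>" by (simp add: w_def norm_mult abs_mult)
      also have "\<dots> \<le> (E * exp (- (\<rho> / 2 * (t - u)))) * (Cl l * exp (- (\<rho> * u)))"
        unfolding Cl_def by (intro mult_mono E q_shift_bound) (use u E0 in auto)
      also have "\<dots> = E * Cl l * (exp (- (\<rho> / 2 * (t - u))) * exp (- (\<rho> * u)))" by (simp add: mult_ac)
      also have "exp (- (\<rho> / 2 * (t - u))) * exp (- (\<rho> * u)) = exp (- (\<rho> / 2 * t)) * exp (- (\<rho> / 2 * u))"
        by (simp add: algebra_simps flip: exp_add)
      finally show ?thesis by (simp add: mult.assoc)
    qed
    have half: "\<rho> / 2 > 0" using rho_pos by simp
    note e = set_integral_split_tail[OF set_integral_exp_tail(1)[OF half] t]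
    have iw': "set_integrable lborel {0..t} (\<lambda>u. E * Cl l * exp (- (\<rho> / 2 * t)) * exp (- (\<rho> / 2 * u)))"
      by (intro set_integrable_mult_right e)
    note wd = dominated_set_integral[OF _ _ iw' wb]
    have iw: "set_integrable lborel {0..t} w" by (rule wd(1)) (auto simp: w_def)
    have "cmod Y \<le> (LINT u:{0..t}|lborel. E * Cl l * exp (- (\<rho> / 2 * t)) * exp (- (\<rho> / 2 * u)))"
      unfolding Y_def by (rule wd(2)) (auto simp: w_def)
    also have "\<dots> = E * Cl l * exp (- (\<rho> / 2 * t)) * (LINT u:{0..t}|lborel. exp (- (\<rho> / 2 * u)))"
      by (rule set_integral_mult_right)
    also have "\<dots> \<le> E * Cl l * exp (- (\<rho> / 2 * t)) * (2 / \<rho>)"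
    proof (intro mult_left_mono)
      have "(LINT u:{0..t}|lborel. exp (- (\<rho> / 2 * u))) = 2 / \<rho> - 2 * exp (- (\<rho> / 2 * t)) / \<rho>"
        using e(2) unfolding set_integral_exp_tail(2)[OF half] by simp
      also have "\<dots> \<le> 2 / \<rho>" using rho_pos by simp
      finally show "(LINT u:{0..t}|lborel. exp (- (\<rho> / 2 * u))) \<le> 2 / \<rho>" .
    qed (use E0 Cl0 in auto)
    finally have Yb: "cmod Y \<le> E * Cl l * (2 / \<rho>) * exp (- (\<rho> / 2 * t))" by (simp add: mult_ac)
    have "exp (- \<theta> * t) * cmod X \<le> exp (- \<theta> * t) * (Cl l * exp (- ((\<rho> - \<theta>) * t)) / (\<rho> - \<theta>))"
      unfolding X_def s_def Cl_def by (intro mult_left_mono sigma_tail t) auto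
    also have "\<dots> = Cl l / (\<rho> - \<theta>) * (exp (- \<theta> * t) * exp (- ((\<rho> - \<theta>) * t)))" by simp
    also have "exp (- \<theta> * t) * exp (- ((\<rho> - \<theta>) * t)) = exp (- (\<rho> * t))"
      by (simp add: algebra_simps flip: exp_add)
    also have "Cl l / (\<rho> - \<theta>) * exp (- (\<rho> * t)) \<le> Cl l / (\<rho> - \<theta>) * exp (- (\<rho> / 2 * t))"
      using Cl0 pos rho_pos t by (intro mult_left_mono) auto
    finally have Xb: "exp (- \<theta> * t) * cmod X \<le> Cl l / (\<rho> - \<theta>) * exp (- (\<rho> / 2 * t))" .
    have \<psi>b: "cmod (\<psi>\<^sub>0 (t + l)) \<le> D * exp (\<rho> * \<bar>l\<bar>) * exp (- (\<rho> / 2 * t))"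
    proof -
      have "cmod (\<psi>\<^sub>0 (t + l)) \<le> D * exp (- (\<rho> * \<bar>t + l\<bar>))"
        using D[of "t + l"] by (simp add: exp_minus field_simps)
      also have "\<dots> \<le> D * exp (\<rho> * \<bar>l\<bar> + - (\<rho> / 2 * t))"
      proof (intro mult_left_mono D0, subst exp_le_cancel_iff)
        have "\<rho> * (t - \<bar>l\<bar>) \<le> \<rho> * \<bar>t + l\<bar>" using rho_pos by (intro mult_left_mono) auto
        moreover have "\<rho> * t \<ge> 0" using rho_pos t by simp
        ultimately show "- (\<rho> * \<bar>t + l\<bar>) \<le> \<rho> * \<bar>l\<bar> + - (\<rho> / 2 * t)"
          by (simp add: right_diff_distrib)
      qed
      also have "\<dots> = D * exp (\<rho> * \<bar>l\<bar>) * exp (- (\<rho> / 2 * t))" by (simp only: exp_add mult.assoc)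
      finally show ?thesis .
    qed
    have "(LINT u:{0..t}|lborel. exp (\<i> * of_real (\<omega> * u)) * complex_of_real (a (t - u) * q (u + l))) =
        (LINT u:{0..t}|lborel. of_real (R * exp (- \<theta> * t)) * s u + w u)"
    proof (intro set_lebesgue_integral_cong allI impI)
      fix u
      have "complex_of_real (exp (- \<theta> * (t - u))) = of_real (exp (- \<theta> * t)) * exp (of_real \<theta> * of_real u)"
        by (simp add: algebra_simps flip: exp_add exp_of_real)
      moreover have "exp ((of_real \<theta> + \<i> * of_real \<omega>) * of_real u) = exp (of_real \<theta> * of_real u) * exp (\<i> * complex_of_real (\<omega> * u))"
        by (simp add: algebra_simps flip: exp_add)
      moreover have "a (t - u) = R * exp (- \<theta> * (t - u)) + d (t - u)" by (simp add: d_def)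
      ultimately show "exp (\<i> * of_real (\<omega> * u)) * complex_of_real (a (t - u) * q (u + l)) =
          of_real (R * exp (- \<theta> * t)) * s u + w u"
        by (simp only: s_def w_def of_real_mult of_real_add) (simp only: algebra_simps)
    qed auto
    also have "\<dots> = of_real (R * exp (- \<theta> * t)) * (LINT u:{0..t}|lborel. s u) + Y"
      unfolding Y_def set_integral_mult_right[symmetric]
      by (intro set_integral_add set_integrable_mult_right is1 iw)
    finally have "\<psi> (t + l) t = exp (\<i> * of_real (\<omega> * t)) * \<psi>\<^sub>0 (t + l) +
        of_real \<omega> * (of_real (R * exp (- \<theta> * t)) * (LINT u:{0..t}|lborel. s u) + Y)"
      using sol duhamel_reflect[OF t, of \<psi>\<^sub>0 a l] unfolding solution_def by simp
    then have "\<psi> (t + l) t - of_real (R * \<omega>) * sigma_fun \<rho> q \<omega> l * of_real (exp (- \<theta> * t)) =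
        exp (\<i> * of_real (\<omega> * t)) * \<psi>\<^sub>0 (t + l) - of_real (\<omega> * R) * (of_real (exp (- \<theta> * t)) * X) + of_real \<omega> * Y"
      unfolding sig of_real_mult by (simp only: algebra_simps)
    also have "cmod \<dots> \<le> cmod (\<psi>\<^sub>0 (t + l)) + \<omega> * \<bar>R\<bar> * (exp (- \<theta> * t) * cmod X) + \<omega> * cmod Y"
      using omega_pos
      by (intro order_trans[OF norm_triangle_ineq] add_mono order_trans[OF norm_triangle_ineq4])
        (auto simp: norm_mult abs_mult)
    also have "\<dots> \<le> D * exp (\<rho> * \<bar>l\<bar>) * exp (- (\<rho> / 2 * t)) + \<omega> * \<bar>R\<bar> * (Cl l / (\<rho> - \<theta>) * exp (- (\<rho> / 2 * t)))
        + \<omega> * (E * Cl l * (2 / \<rho>) * exp (- (\<rho> / 2 * t)))"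
      by (intro add_mono \<psi>b mult_left_mono Xb Yb) (use omega_pos in auto)
    also have "\<dots> = H l * exp (- (\<rho> / 2 * t))" by (simp add: H_def algebra_simps)
    finally show ?thesis .
  qed
  moreover have "R * \<omega> = \<beta> \<psi>\<^sub>0 a\<^sub>0 * \<omega> * r" by (simp add: R_def mult_ac)
  ultimately show ?thesis using that[of H] by simp
qed

lemma solution_expansion_weighted_norm:
  assumes "\<psi>\<^sub>0 \<in> borel_measurable borel" "\<And>x. exp (\<rho> * \<bar>x\<bar>) * cmod (\<psi>\<^sub>0 x) \<le> D"
    and "solution \<omega> q \<psi>\<^sub>0 a\<^sub>0 \<psi> a"
  shows "\<exists>\<eta> :: real \<Rightarrow> real \<Rightarrow> complex.
    (\<forall>l. \<forall>t\<ge>0. \<psi> (t + l) t = of_real (\<beta> \<psi>\<^sub>0 a\<^sub>0 * \<omega> * r) * sigma_fun \<rho> q \<omega> l * of_real (exp (- theta \<rho> q \<omega> * t)) + \<eta> l t) \<and>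
    (\<forall>\<rho>'<\<rho> / 2. \<forall>l. weighted_norm \<rho>' (\<eta> l) < \<infinity>)"
proof -
  define \<eta> where "\<eta> = (\<lambda>l t. \<psi> (t + l) t - of_real (\<beta> \<psi>\<^sub>0 a\<^sub>0 * \<omega> * r) * sigma_fun \<rho> q \<omega> l * of_real (exp (- \<theta> * t)))"
  obtain H where H: "\<And>l t. t \<ge> 0 \<Longrightarrow> cmod (\<eta> l t) \<le> H l * exp (- (\<rho> / 2 * t))"
    using solution_expansion[OF assms] unfolding \<eta>_def by blast
  have "weighted_norm \<rho>' (\<eta> l) < \<infinity>" if \<rho>': "\<rho>' < \<rho> / 2" for \<rho>' l
  proof -
    have "weighted_norm \<rho>' (\<eta> l) \<le> ennreal (H l)"
      unfolding weighted_norm_def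
    proof (intro SUP_least ennreal_leI)
      fix t :: real assume "t \<in> {0..}"
      then have t: "t \<ge> 0" by simp
      have H0: "H l \<ge> 0" using order_trans[OF norm_ge_zero H[of 0 l]] by simp
      \<comment> \<open>Comparing the exponents needs only t \<ge> 0, so negative \<rho>' is covered
        as well.\<close>
      have "exp (\<rho>' * t) * cmod (\<eta> l t) \<le> exp (\<rho> / 2 * t) * (H l * exp (- (\<rho> / 2 * t)))"
        using mult_right_mono[OF less_imp_le[OF \<rho>'] t] t by (intro mult_mono H) auto
      also have "\<dots> = H l" by (simp add: exp_minus)
      finally show "exp (\<rho>' * t) * cmod (\<eta> l t) \<le> H l" .
    qed
    then show ?thesis by (simp add: le_less_trans)
  qed
  then show ?thesis
    by (intro exI[of _ \<eta>]) (auto simp: \<eta>_def \<theta>_def)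
qed

end

theorem theorem4p2:
  fixes \<rho> :: real and q :: "real \<Rightarrow> real"
  assumes "\<rho> > 0"
    and "W1_infty (\<lambda>x. exp (\<rho> * \<bar>x\<bar>) * q x)"
  shows "\<exists>r :: real \<Rightarrow> real. (\<lambda>\<omega>. r \<omega> - 1) \<in> O[at_top](\<lambda>\<omega>. 1 / \<omega>) \<and>
    (\<forall>\<^sub>F \<omega> in at_top.
      unique_simple_pole_at \<rho> q \<omega> (- theta \<rho> q \<omega>) \<and>
      (\<forall>a\<^sub>0 \<psi> a. solution \<omega> q (\<lambda>x. 0) a\<^sub>0 \<psi> a \<longrightarrow>
        (\<exists>\<eta> :: real \<Rightarrow> real \<Rightarrow> complex.
          (\<forall>l. \<forall>t\<ge>0. \<psi> (t + l) t =
             of_real (a\<^sub>0 * \<omega> * r \<omega>) * sigma_fun \<rho> q \<omega> l * of_real (exp (- theta \<rho> q \<omega> * t)) + \<eta> l t) \<and>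
          (\<forall>\<rho>'<\<rho> / 2. \<forall>l. weighted_norm \<rho>' (\<eta> l) < \<infinity>))) \<and>
      (\<forall>\<psi>\<^sub>0 a\<^sub>0. \<psi>\<^sub>0 \<in> borel_measurable lborel \<and> (\<exists>C. \<forall>x. exp (\<rho> * \<bar>x\<bar>) * cmod (\<psi>\<^sub>0 x) \<le> C) \<longrightarrow>
        (\<exists>\<beta> :: real. \<forall>\<psi> a. solution \<omega> q \<psi>\<^sub>0 a\<^sub>0 \<psi> a \<longrightarrow>
          (\<exists>\<eta> :: real \<Rightarrow> real \<Rightarrow> complex.
            (\<forall>l. \<forall>t\<ge>0. \<psi> (t + l) t =
               of_real (\<beta> * \<omega> * r \<omega>) * sigma_fun \<rho> q \<omega> l * of_real (exp (- theta \<rho> q \<omega> * t)) + \<eta> l t) \<and>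
            (\<forall>\<rho>'<\<rho> / 2. \<forall>l. weighted_norm \<rho>' (\<eta> l) < \<infinity>)))))"
proof -
  obtain C L p where profile: "exp_profile \<rho> C L p" and eq: "AE x in lborel. q x = p x" and q: "q \<in> borel_measurable borel"
    using W1_infty_imp_exp_profile[OF assms] .
  interpret exp_profile \<rho> C L p by (rule profile)
  note eqs = unique_simple_pole_at_cong[OF eq q_measurable q] theta_cong[OF eq q_measurable q]
    sigma_fun_cong[OF eq q_measurable q]
  note sol_p = solution_cong[OF eq q_measurable q]
  \<comment> \<open>Outside its locale this constant takes only \<rho>, the profile and \<omega>, so
    one r serves both parts and all initial data.\<close>
  define r where "r = exp_profile_large.r \<rho> p"
  have loc: "exp_profile_large \<rho> C L p \<omega>" if "large \<omega>" for \<omega>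
    using that by unfold_locales
  have "(\<lambda>\<omega>. r \<omega> - 1) \<in> O[at_top](\<lambda>\<omega>. 1 / \<omega>)"
  proof (rule bigoI)
    show "\<forall>\<^sub>F \<omega> in at_top. norm (r \<omega> - 1) \<le> 4 * M / \<rho> * norm (1 / \<omega>)"
      using eventually_large eventually_gt_at_top[of 0]
      by eventually_elim (use exp_profile_large.r_bound[OF loc] in \<open>auto simp: r_def\<close>)
  qed
  moreover have "\<forall>\<^sub>F \<omega> in at_top.
      unique_simple_pole_at \<rho> q \<omega> (- theta \<rho> q \<omega>) \<and>
      (\<forall>a\<^sub>0 \<psi> a. solution \<omega> q (\<lambda>x. 0) a\<^sub>0 \<psi> a \<longrightarrow>
        (\<exists>\<eta> :: real \<Rightarrow> real \<Rightarrow> complex.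
          (\<forall>l. \<forall>t\<ge>0. \<psi> (t + l) t =
             of_real (a\<^sub>0 * \<omega> * r \<omega>) * sigma_fun \<rho> q \<omega> l * of_real (exp (- theta \<rho> q \<omega> * t)) + \<eta> l t) \<and>
          (\<forall>\<rho>'<\<rho> / 2. \<forall>l. weighted_norm \<rho>' (\<eta> l) < \<infinity>))) \<and>
      (\<forall>\<psi>\<^sub>0 a\<^sub>0. \<psi>\<^sub>0 \<in> borel_measurable lborel \<and> (\<exists>C. \<forall>x. exp (\<rho> * \<bar>x\<bar>) * cmod (\<psi>\<^sub>0 x) \<le> C) \<longrightarrow>
        (\<exists>\<beta> :: real. \<forall>\<psi> a. solution \<omega> q \<psi>\<^sub>0 a\<^sub>0 \<psi> a \<longrightarrow>
          (\<exists>\<eta> :: real \<Rightarrow> real \<Rightarrow> complex.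
            (\<forall>l. \<forall>t\<ge>0. \<psi> (t + l) t =
               of_real (\<beta> * \<omega> * r \<omega>) * sigma_fun \<rho> q \<omega> l * of_real (exp (- theta \<rho> q \<omega> * t)) + \<eta> l t) \<and>
            (\<forall>\<rho>'<\<rho> / 2. \<forall>l. weighted_norm \<rho>' (\<eta> l) < \<infinity>))))"
    using eventually_large
  proof eventually_elim
    case (elim \<omega>)
    interpret P: exp_profile_large \<rho> C L p \<omega> by (rule loc[OF elim])
    show ?case
      unfolding eqs
    proof (intro conjI allI impI, goal_cases)
      case 1
      show ?case by (rule unique_simple_pole_theta(1)[OF elim])
    next
      case (2 a\<^sub>0 \<psi> a)
      \<comment> \<open>Part (1) is the case of zero initial field, with weight bound 0 and \<beta>
        = \<open>a\<^sub>0\<close> by \<open>beta_zero\<close>.\<close>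
      show ?case
        using P.solution_expansion_weighted_norm[of "\<lambda>_. 0" 0, OF _ _ sol_p[OF 2]]
        unfolding P.beta_zero r_def by simp
    next
      case (3 \<psi>\<^sub>0 a\<^sub>0)
      then obtain D where "\<psi>\<^sub>0 \<in> borel_measurable borel" "\<And>x. exp (\<rho> * \<bar>x\<bar>) * cmod (\<psi>\<^sub>0 x) \<le> D"
        by auto
      \<comment> \<open>The witness \<open>P.\<beta>\<close> is computed from the initial data
        alone, so it can be fixed before the solution is.\<close>
      from P.solution_expansion_weighted_norm[OF this sol_p] show ?case
        unfolding r_def by (intro exI[of _ "P.\<beta> \<psi>\<^sub>0 a\<^sub>0"] allI impI)
    qed
  qed
  ultimately show ?thesis by blast
qed

end
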